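(* Let $\Gamma$ be a finitely generated abelian group, $\mathcal{A}$ a finite list of elements of $\Gamma$, and $G=(\mathbb{S}^1)^p\times\mathbb{R}^q\times F$ with $p,q\ge0$ integers, $F$ a finite abelian group, and $g=p+q\in\mathbb{Z}_{>0}$. Then $$\chi^{\mathrm{par}}_{\mathcal{A}(G)}(t)=\chi^G_{\mathcal{A}}\big(\#F\cdot t^g\big).$$
   Context: $G$ is written additively with its usual Lie group topology ($F$ discrete); $T=\operatorname{Hom}(\Gamma,G)$. For $\alpha\in\mathcal{A}$, $H_{\alpha,G}=\{\varphi\in T\mid\varphi(\alpha)=0\}$; for a sublist $\mathcal{S}\subseteq\mathcal{A}$, $H_{\mathcal{S},G}=\bigcap_{\alpha\in\mathcal{S}}H_{\alpha,G}$ ($H_{\emptyset,G}=T$); each connected component of $H_{\mathcal{S},G}$ is a manifold of dimension $g(r_\Gamma-r_{\mathcal{S}})$, where $r_{\mathcal{S}}$ is the rank of the subgroup $\langle\mathcal{S}\rangle$ generated by $\mathcal{S}$ and $r_\Gamma$ the rank of $\Gamma$. The total intersection poset $L$ is the set of connected components of all nonempty $H_{\mathcal{S},G}$, $\mathcal{S}\subseteq\mathcal{A}$, ordered by reverse inclusion, with Möbius function $\mu$. For $\mathcal{C}\in L$, $T^{\mathcal{C}}$ is the connected component of $T$ containing $\mathcal{C}$. Let $\Gamma_{\operatorname{tor}}$ be the torsion subgroup and $\mathcal{A}^{\operatorname{tor}}=\mathcal{A}\cap\Gamma_{\operatorname{tor}}$; $\mathrm{scc}(T)$ is the set of connected components $T_i$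 of $T$ with no $\alpha\in\mathcal{A}^{\operatorname{tor}}$ such that $T_i\subseteq H_{\alpha,G}$; $L^{\mathrm{par}}=\{\mathcal{C}\in L\mid T^{\mathcal{C}}\in\mathrm{scc}(T)\}$. The partial characteristic polynomial is $\chi^{\mathrm{par}}_{\mathcal{A}(G)}(t)=\sum_{\mathcal{C}\in L^{\mathrm{par}}}\mu(T^{\mathcal{C}},\mathcal{C})t^{\dim\mathcal{C}}$. With $m(\mathcal{S};G)=\#\operatorname{Hom}((\Gamma/\langle\mathcal{S}\rangle)_{\operatorname{tor}},G)$, the $G$-Tutte polynomial is $T^G_{\mathcal{A}}(x,y)=\sum_{\mathcal{S}\subseteq\mathcal{A}}m(\mathcal{S};G)(x-1)^{r_{\mathcal{A}}-r_{\mathcal{S}}}(y-1)^{\#\mathcal{S}-r_{\mathcal{S}}}$ and the $G$-characteristic polynomial is $\chi^G_{\mathcal{A}}(t)=(-1)^{r_{\mathcal{A}}}t^{r_\Gamma-r_{\mathcal{A}}}T^G_{\mathcal{A}}(1-t,0)$. *)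

theory Defs
  imports "HOL-Analysis.Analysis" "HOL-Algebra.Coset" "HOL-Algebra.Generated_Groups" "HOL-Algebra.FiniteProduct"
    "HOL-Computational_Algebra.Polynomial"
begin

definition fin_gen :: "('a, 'b) monoid_scheme \<Rightarrow> bool" where
  "fin_gen \<Gamma> \<longleftrightarrow> (\<exists>X. finite X \<and> X \<subseteq> carrier \<Gamma> \<and> generate \<Gamma> X = carrier \<Gamma>)"

definition tor_set :: "('a, 'b) monoid_scheme \<Rightarrow> 'a set" where
  "tor_set Q = {x \<in> carrier Q. \<exists>n::nat. n > 0 \<and> x [^]\<^bsub>Q\<^esub> n = \<one>\<^bsub>Q\<^esub>}"

definition tor_group :: "('a, 'b) monoid_scheme \<Rightarrow> ('a, 'b) monoid_scheme" where
  "tor_group Q = Q\<lparr>carrier := tor_set Q\<rparr>"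

definition zindep :: "('a, 'b) monoid_scheme \<Rightarrow> 'a set \<Rightarrow> bool" where
  "zindep \<Gamma> X \<longleftrightarrow> finite X \<and> X \<subseteq> carrier \<Gamma> \<and>
     (\<forall>c::'a \<Rightarrow> int. finprod \<Gamma> (\<lambda>x. x [^]\<^bsub>\<Gamma>\<^esub> c x) X = \<one>\<^bsub>\<Gamma>\<^esub> \<longrightarrow> (\<forall>x\<in>X. c x = 0))"

definition grank :: "('a, 'b) monoid_scheme \<Rightarrow> 'a set \<Rightarrow> nat" where
  "grank \<Gamma> H = Max (card ` {X. X \<subseteq> H \<and> zindep \<Gamma> X})"

definition rk_sub :: "('a, 'b) monoid_scheme \<Rightarrow> 'a list \<Rightarrow> nat set \<Rightarrow> nat" where
  "rk_sub \<Gamma> A S = grank \<Gamma> (generate \<Gamma> ((\<lambda>i. A ! i) ` S))"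

definition homs :: "('a, 'c) monoid_scheme \<Rightarrow> ('b, 'd) monoid_scheme \<Rightarrow> ('a \<Rightarrow> 'b) set" where
  "homs Q G = {h. h \<in> hom Q G \<and> h \<in> extensional (carrier Q)}"

text \<open>S^1 is the unit circle in C (group written multiplicatively here); coordinates i \<ge> p
  (resp. i \<ge> q) are fixed to the neutral element.\<close>
definition circ_set :: "nat \<Rightarrow> (nat \<Rightarrow> complex) set" where
  "circ_set p = {u. (\<forall>i<p. cmod (u i) = 1) \<and> (\<forall>i\<ge>p. u i = 1)}"

definition real_set :: "nat \<Rightarrow> (nat \<Rightarrow> real) set" where
  "real_set q = {v. \<forall>i\<ge>q. v i = 0}"

type_synonym 'f Gelem = "(nat \<Rightarrow> complex) \<times> (nat \<Rightarrow> real) \<times> 'f"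

definition Ggrp :: "nat \<Rightarrow> nat \<Rightarrow> ('f, 'e) monoid_scheme \<Rightarrow> 'f Gelem monoid" where
  "Ggrp p q F = \<lparr>carrier = circ_set p \<times> real_set q \<times> carrier F,
     mult = (\<lambda>(u, v, f) (u', v', f'). (\<lambda>i. u i * u' i, \<lambda>i. v i + v' i, f \<otimes>\<^bsub>F\<^esub> f')),
     one = (\<lambda>_. 1, \<lambda>_. 0, \<one>\<^bsub>F\<^esub>)\<rparr>"

definition Gtop :: "nat \<Rightarrow> nat \<Rightarrow> ('f, 'e) monoid_scheme \<Rightarrow> 'f Gelem topology" where
  "Gtop p q F = prod_topology (top_of_set (circ_set p))
      (prod_topology (top_of_set (real_set q)) (discrete_topology (carrier F)))"

definition Tspace :: "('g, 'b) monoid_scheme \<Rightarrow> nat \<Rightarrow> nat \<Rightarrow> ('f, 'e) monoid_scheme \<Rightarrow> ('g \<Rightarrow> 'f Gelem) set" where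
  "Tspace \<Gamma> p q F = homs \<Gamma> (Ggrp p q F)"

text \<open>Topology of T: pointwise convergence (compact-open topology, \<Gamma> discrete).\<close>
definition Ttop :: "('g, 'b) monoid_scheme \<Rightarrow> nat \<Rightarrow> nat \<Rightarrow> ('f, 'e) monoid_scheme \<Rightarrow> ('g \<Rightarrow> 'f Gelem) topology" where
  "Ttop \<Gamma> p q F = subtopology (product_topology (\<lambda>_. Gtop p q F) (carrier \<Gamma>)) (Tspace \<Gamma> p q F)"

definition Hsub :: "('g, 'b) monoid_scheme \<Rightarrow> 'g list \<Rightarrow> nat \<Rightarrow> nat \<Rightarrow> ('f, 'e) monoid_scheme \<Rightarrow> nat set \<Rightarrow> ('g \<Rightarrow> 'f Gelem) set" where
  "Hsub \<Gamma> A p q F S = {\<phi> \<in> Tspace \<Gamma> p q F. \<forall>i\<in>S. \<phi> (A ! i) = \<one>\<^bsub>Ggrp p q F\<^esub>}"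

definition Lposet :: "('g, 'b) monoid_scheme \<Rightarrow> 'g list \<Rightarrow> nat \<Rightarrow> nat \<Rightarrow> ('f, 'e) monoid_scheme \<Rightarrow> ('g \<Rightarrow> 'f Gelem) set set" where
  "Lposet \<Gamma> A p q F = \<Union> {connected_components_of (subtopology (Ttop \<Gamma> p q F) (Hsub \<Gamma> A p q F S)) | S.
        S \<subseteq> {..<length A} \<and> Hsub \<Gamma> A p q F S \<noteq> {}}"

definition Tcomp :: "('g, 'b) monoid_scheme \<Rightarrow> nat \<Rightarrow> nat \<Rightarrow> ('f, 'e) monoid_scheme \<Rightarrow> ('g \<Rightarrow> 'f Gelem) set \<Rightarrow> ('g \<Rightarrow> 'f Gelem) set" where
  "Tcomp \<Gamma> p q F C = (THE D. D \<in> connected_components_of (Ttop \<Gamma> p q F) \<and> C \<subseteq> D)"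

definition scc :: "('g, 'b) monoid_scheme \<Rightarrow> 'g list \<Rightarrow> nat \<Rightarrow> nat \<Rightarrow> ('f, 'e) monoid_scheme \<Rightarrow> ('g \<Rightarrow> 'f Gelem) set set" where
  "scc \<Gamma> A p q F = {D \<in> connected_components_of (Ttop \<Gamma> p q F).
       \<not> (\<exists>i<length A. A ! i \<in> tor_set \<Gamma> \<and> D \<subseteq> Hsub \<Gamma> A p q F {i})}"

definition Lpar :: "('g, 'b) monoid_scheme \<Rightarrow> 'g list \<Rightarrow> nat \<Rightarrow> nat \<Rightarrow> ('f, 'e) monoid_scheme \<Rightarrow> ('g \<Rightarrow> 'f Gelem) set set" where
  "Lpar \<Gamma> A p q F = {C \<in> Lposet \<Gamma> A p q F. Tcomp \<Gamma> p q F C \<in> scc \<Gamma> A p q F}"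

text \<open>Dimension of C \<in> L: C is a connected component of H_{S_C} for the maximal sublist
  S_C = {\<alpha> \<in> A | C \<subseteq> H_\<alpha>}, hence a manifold of dimension g (r_\<Gamma> - r_{S_C}).\<close>
definition Ldim :: "('g, 'b) monoid_scheme \<Rightarrow> 'g list \<Rightarrow> nat \<Rightarrow> nat \<Rightarrow> ('f, 'e) monoid_scheme \<Rightarrow> ('g \<Rightarrow> 'f Gelem) set \<Rightarrow> nat" where
  "Ldim \<Gamma> A p q F C = (p + q) * (grank \<Gamma> (carrier \<Gamma>)
       - rk_sub \<Gamma> A {i. i < length A \<and> C \<subseteq> Hsub \<Gamma> A p q F {i}})"

fun mobius_aux :: "'a set \<Rightarrow> ('a \<Rightarrow> 'a \<Rightarrow> bool) \<Rightarrow> nat \<Rightarrow> 'a \<Rightarrow> 'a \<Rightarrow> int" where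
  "mobius_aux P lesseq 0 x y = (if x = y then 1 else 0)"
| "mobius_aux P lesseq (Suc n) x y =
     (if x = y then 1
      else if lesseq x y then - (\<Sum>z\<in>{z \<in> P. lesseq x z \<and> lesseq z y \<and> z \<noteq> y}. mobius_aux P lesseq n x z)
      else 0)"

text \<open>The recursion depth card P exceeds the length of every chain, so this is the usual
  Moebius function: \<mu>(x,x) = 1, \<mu>(x,y) = - \<Sum>_{x \<le> z < y} \<mu>(x,z) for x < y, 0 otherwise.\<close>
definition mobius :: "'a set \<Rightarrow> ('a \<Rightarrow> 'a \<Rightarrow> bool) \<Rightarrow> 'a \<Rightarrow> 'a \<Rightarrow> int" where
  "mobius P lesseq x y = mobius_aux P lesseq (card P) x y"

definition chi_par :: "('g, 'b) monoid_scheme \<Rightarrow> 'g list \<Rightarrow> nat \<Rightarrow> nat \<Rightarrow> ('f, 'e) monoid_scheme \<Rightarrow> int poly" where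
  "chi_par \<Gamma> A p q F =
     (\<Sum>C\<in>Lpar \<Gamma> A p q F.
        monom (mobius (Lposet \<Gamma> A p q F) (\<lambda>C D. D \<subseteq> C) (Tcomp \<Gamma> p q F C) C) (Ldim \<Gamma> A p q F C))"

definition mult_G :: "('g, 'b) monoid_scheme \<Rightarrow> 'g list \<Rightarrow> nat \<Rightarrow> nat \<Rightarrow> ('f, 'e) monoid_scheme \<Rightarrow> nat set \<Rightarrow> nat" where
  "mult_G \<Gamma> A p q F S =
     card (homs (tor_group (\<Gamma> Mod (generate \<Gamma> ((\<lambda>i. A ! i) ` S)))) (Ggrp p q F))"

definition tutte_G :: "('g, 'b) monoid_scheme \<Rightarrow> 'g list \<Rightarrow> nat \<Rightarrow> nat \<Rightarrow> ('f, 'e) monoid_scheme \<Rightarrow> 'r \<Rightarrow> 'r \<Rightarrow> 'r::comm_ring_1" where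
  "tutte_G \<Gamma> A p q F x y =
     (\<Sum>S\<in>Pow {..<length A}. of_nat (mult_G \<Gamma> A p q F S)
        * (x - 1) ^ (rk_sub \<Gamma> A {..<length A} - rk_sub \<Gamma> A S)
        * (y - 1) ^ (card S - rk_sub \<Gamma> A S))"

definition chi_G :: "('g, 'b) monoid_scheme \<Rightarrow> 'g list \<Rightarrow> nat \<Rightarrow> nat \<Rightarrow> ('f, 'e) monoid_scheme \<Rightarrow> int poly" where
  "chi_G \<Gamma> A p q F =
     (- 1) ^ rk_sub \<Gamma> A {..<length A} * monom 1 (grank \<Gamma> (carrier \<Gamma>) - rk_sub \<Gamma> A {..<length A})
     * tutte_G \<Gamma> A p q F (1 - [:0, 1:]) 0"

end

theory Submission
  imports Defs
begin

text \<open>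
  Put \<open>K = {x. nx \<in> \<langle>S\<rangle> for some n > 0}\<close>; then \<open>\<Gamma>/K\<close> is free of rank \<open>r\<^sub>\<Gamma> - r\<^sub>S\<close>. On a connected subset of
  \<open>H\<^sub>S\<close> the restriction to \<open>K\<close> takes values in a finite subset of \<open>G\<close> at each point, and the \<open>F\<close>-part
  is locally constant, so both are constant; conversely, two homomorphisms agreeing in these data
  differ by one that lifts to a vector space, hence are joined by a path. Therefore \<open>H\<^sub>S\<close> has
  \<open>m(S;G) \<cdot> (#F)^(r\<^sub>\<Gamma> - r\<^sub>S)\<close> components, and an element of \<open>\<Gamma>\<close> vanishing on one of them lies in \<open>K\<close>.
  For \<open>C \<in> L\<close> let \<open>w(C)\<close> be the sum of \<open>(-1)^#S\<close> over all \<open>S\<close> having \<open>C\<close> as a component of \<open>H\<^sub>S\<close>. The sum of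
  \<open>w\<close> over all elements of \<open>L\<close> containing \<open>C\<close> is an alternating sum over the subsets of
  \<open>{\<alpha>. C \<subseteq> H\<^sub>\<alpha>}\<close>. Hence \<open>w(C) = \<mu>(T\<^sup>C, C)\<close> if \<open>T\<^sup>C\<close> lies in no \<open>H\<^sub>\<alpha>\<close>, and \<open>w(C) = 0\<close> otherwise, and
  exchanging summations turns the partial characteristic polynomial into
  \<open>\<Sum>S. (-1)^#S \<cdot> m(S;G) \<cdot> (#F \<cdot> t\<^sup>g)^(r\<^sub>\<Gamma> - r\<^sub>S)\<close>.
\<close>

subsection \<open>Ranks of finitely generated abelian groups\<close>

text \<open>Gaussian elimination without division: an equation with a nonzero pivot eliminates one
  unknown from the others after they are multiplied by the pivot, so everything stays integral. An
  equation without a pivot holds for every \<open>c\<close>.\<close>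

lemma integer_system_nontrivial:
  fixes M :: "'i \<Rightarrow> 'j \<Rightarrow> int"
  assumes "finite I" "finite J" "card I < card J"
  shows "\<exists>c. (\<exists>j\<in>J. c j \<noteq> 0) \<and> (\<forall>i\<in>I. (\<Sum>j\<in>J. M i j * c j) = 0)"
  using assms
proof (induction I arbitrary: J M rule: finite_induct)
  case empty
  then have "J \<noteq> {}" by auto
  then show ?case by (intro exI[of _ "\<lambda>_. 1"]) auto
next
  case (insert i0 I)
  show ?case
  proof (cases "\<forall>j\<in>J. M i0 j = 0")
    case True
    have "card I < card J" using insert by simp
    from insert.IH[OF insert.prems(1) this] True show ?thesis by fastforce
  next
    case False
    then obtain j0 where j0: "j0 \<in> J" "M i0 j0 \<noteq> 0" by auto
    define a where "a = M i0 j0"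
    define J' where "J' = J - {j0}"
    have J': "finite J'" "card I < card J'" "j0 \<notin> J'" "J = insert j0 J'"
      using insert j0 by (auto simp: J'_def)
    obtain c where c: "\<exists>j\<in>J'. c j \<noteq> 0"
      "\<And>i. i \<in> I \<Longrightarrow> (\<Sum>j\<in>J'. (a * M i j - M i j0 * M i0 j) * c j) = 0"
      using insert.IH[OF J'(1,2), of "\<lambda>i j. a * M i j - M i j0 * M i0 j"] by blast
    \<comment> \<open>Back substitution: \<open>c\<close> is scaled by the pivot, and the value at
      \<open>j0\<close> is the one that solves equation \<open>i0\<close>.\<close>
    define d where "d = (\<lambda>j. if j = j0 then - (\<Sum>j\<in>J'. M i0 j * c j) else a * c j)"
    have eq: "(\<Sum>j\<in>J. M i j * d j) =
        (\<Sum>j\<in>J'. (a * M i j - M i j0 * M i0 j) * c j)" for i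
    proof -
      have "(\<Sum>j\<in>J. M i j * d j) = M i j0 * d j0 + (\<Sum>j\<in>J'. M i j * d j)"
        using J' by simp
      also have "(\<Sum>j\<in>J'. M i j * d j) = (\<Sum>j\<in>J'. a * M i j * c j)"
        using J'(3) by (intro sum.cong) (auto simp: d_def)
      also have "M i j0 * d j0 = (\<Sum>j\<in>J'. - (M i j0 * M i0 j * c j))"
        by (simp add: d_def sum_distrib_left sum_negf mult.assoc)
      finally show ?thesis by (simp add: sum.distrib[symmetric] algebra_simps)
    qed
    have "(\<Sum>j\<in>J. M i0 j * d j) = 0"
      unfolding eq by (simp add: a_def)
    moreover have "\<exists>j\<in>J. d j \<noteq> 0"
      using c(1) J' j0 by (auto simp: d_def a_def)
    ultimately show ?thesis using c(2) eq by (intro exI[of _ d]) auto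
  qed
qed

section \<open>Integer combinations in a multiplicatively written abelian group\<close>

abbreviation lincomb :: "('a, 'b) monoid_scheme \<Rightarrow> ('i \<Rightarrow> 'a) \<Rightarrow> 'i set \<Rightarrow> ('i \<Rightarrow> int) \<Rightarrow> 'a" where
  "lincomb G e I c \<equiv> finprod G (\<lambda>i. e i [^]\<^bsub>G\<^esub> c i) I"

text \<open>For a subgroup \<open>N\<close> of an abelian group this is the preimage of the torsion
  subgroup of the quotient by \<open>N\<close>, so the quotient by it is torsion-free.\<close>

definition saturation :: "('a, 'b) monoid_scheme \<Rightarrow> 'a set \<Rightarrow> 'a set" where
  "saturation G N = {x \<in> carrier G. \<exists>n::nat. n > 0 \<and> x [^]\<^bsub>G\<^esub> n \<in> N}"

context comm_group
begin

lemma lincomb_closed: "e \<in> I \<rightarrow> carrier G \<Longrightarrow> lincomb G e I c \<in> carrier G"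
  by (rule finprod_closed) auto

lemma lincomb_add:
  assumes "e \<in> I \<rightarrow> carrier G"
  shows "lincomb G e I (\<lambda>i. c i + d i) = lincomb G e I c \<otimes> lincomb G e I d"
proof -
  have "lincomb G e I (\<lambda>i. c i + d i) = finprod G (\<lambda>i. e i [^] c i \<otimes> e i [^] d i) I"
    using assms by (intro finprod_cong') (auto simp: int_pow_mult Pi_iff)
  also have "\<dots> = lincomb G e I c \<otimes> lincomb G e I d"
    using assms by (intro finprod_multf) auto
  finally show ?thesis .
qed

lemma lincomb_minus:
  assumes "e \<in> I \<rightarrow> carrier G" shows "lincomb G e I (\<lambda>i. - c i) = inv (lincomb G e I c)"
proof -
  have "lincomb G e I (\<lambda>i. - c i) \<otimes> lincomb G e I c = \<one>"
    by (subst lincomb_add[OF assms, symmetric]) simp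
  then show ?thesis using lincomb_closed[OF assms] by (metis inv_equality)
qed

lemma lincomb_nat_pow:
  assumes "e \<in> I \<rightarrow> carrier G" shows "lincomb G e I c [^] (n::nat) = lincomb G e I (\<lambda>i. int n * c i)"
proof (induction n)
  case 0 then show ?case by simp
next
  case (Suc n)
  have "lincomb G e I (\<lambda>i. int (Suc n) * c i) = lincomb G e I (\<lambda>i. int n * c i + c i)"
    by (simp add: algebra_simps)
  then show ?case using Suc by (simp add: lincomb_add[OF assms])
qed

lemma lincomb_int_pow:
  assumes "e \<in> I \<rightarrow> carrier G" shows "lincomb G e I c [^] (k::int) = lincomb G e I (\<lambda>i. k * c i)"
proof (cases k rule: int_cases2)
  case (nonneg n)
  then show ?thesis using lincomb_nat_pow[OF assms] by (simp add: int_pow_int)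
next
  case (nonpos n)
  have "lincomb G e I c [^] k = inv (lincomb G e I (\<lambda>i. int n * c i))"
    using nonpos lincomb_nat_pow[OF assms] lincomb_closed[OF assms] by (simp add: int_pow_neg int_pow_int)
  then show ?thesis using nonpos by (simp add: lincomb_minus[OF assms])
qed

lemma lincomb_sum:
  assumes "e \<in> I \<rightarrow> carrier G" "finite J"
  shows "finprod G (\<lambda>j. lincomb G e I (m j)) J = lincomb G e I (\<lambda>i. \<Sum>j\<in>J. m j i)"
  using assms(2)
proof (induction J rule: finite_induct)
  case empty then show ?case by simp
next
  case (insert j J)
  have "(\<lambda>j. lincomb G e I (m j)) \<in> J \<rightarrow> carrier G" using lincomb_closed[OF assms(1)] by auto
  then show ?case using insert lincomb_closed[OF assms(1)] by (simp add: lincomb_add[OF assms(1)])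
qed

lemma lincomb_single:
  assumes "e \<in> I \<rightarrow> carrier G" "finite I" "i \<in> I"
  shows "lincomb G e I (\<lambda>j. if j = i then k else 0) = e i [^] k"
proof -
  have "lincomb G e I (\<lambda>j. if j = i then k else 0) = finprod G (\<lambda>j. if i = j then e j [^] k else \<one>) I"
    using assms by (intro finprod_cong') (auto simp: Pi_iff)
  moreover have "(\<lambda>j. e j [^] k) \<in> I \<rightarrow> carrier G" using assms(1) by auto
  ultimately show ?thesis using finprod_singleton[OF assms(3,2), of "\<lambda>j. e j [^] k"] by simp
qed

lemma lincomb_in_subgroup:
  assumes "subgroup H G" "finite I" "\<And>i. i \<in> I \<Longrightarrow> e i \<in> H"
  shows "lincomb G e I c \<in> H"
  using assms(2,3)
proof (induction I rule: finite_induct)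
  case empty then show ?case using assms(1) by (simp add: subgroup.one_closed)
next
  case (insert i I)
  have H: "H \<subseteq> carrier G" using assms(1) by (rule subgroup.subset)
  have "lincomb G e (insert i I) c = e i [^] c i \<otimes> lincomb G e I c"
    using insert H by (intro finprod_insert) auto
  then show ?case using insert assms(1) by (auto intro!: subgroup.m_closed subgroup_int_pow_closed)
qed

lemma hom_lincomb:
  assumes "comm_group H" "h \<in> hom G H" "finite I" "e \<in> I \<rightarrow> carrier G"
  shows "h (lincomb G e I c) = lincomb H (\<lambda>i. h (e i)) I c"
proof -
  interpret H: comm_group H by fact
  show ?thesis using assms(3,4)
  proof (induction I rule: finite_induct)
    case empty
    then show ?case using hom_one[OF assms(2)] is_group H.is_group by simp
  next
    case (insert i I)
    have c: "(\<lambda>i. h (e i)) \<in> I \<rightarrow> carrier H" "h (e i) \<in> carrier H"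
      using insert assms(2) by (auto simp: hom_def)
    have "h (lincomb G e (insert i I) c) = h (e i [^] c i \<otimes> lincomb G e I c)"
      using insert by (subst finprod_insert) auto
    also have "\<dots> = h (e i [^] c i) \<otimes>\<^bsub>H\<^esub> h (lincomb G e I c)"
      using insert assms(2) by (intro hom_mult) (auto intro: lincomb_closed)
    also have "h (e i [^] c i) = h (e i) [^]\<^bsub>H\<^esub> c i"
      using insert hom_int_pow[OF assms(2)] is_group H.is_group by auto
    also have "h (lincomb G e I c) = lincomb H (\<lambda>i. h (e i)) I c" using insert by auto
    finally show ?case using insert c by (simp add: Pi_iff)
  qed
qed

lemma generate_lincomb:
  assumes "finite I" "e \<in> I \<rightarrow> carrier G" "x \<in> generate G (e ` I)"
  shows "\<exists>c. x = lincomb G e I c"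
  using assms(3)
proof (induction rule: generate.induct)
  case one then show ?case by (intro exI[of _ "\<lambda>_. 0"]) simp
next
  case (incl h)
  then obtain i where "i \<in> I" "h = e i" by auto
  with lincomb_single[OF assms(2,1), of i 1] assms(2) show ?case
    by (intro exI[of _ "\<lambda>j. if j = i then 1 else 0"]) (auto simp: Pi_iff)
next
  case (inv h)
  then obtain i where "i \<in> I" "h = e i" by auto
  with lincomb_single[OF assms(2,1), of i "-1"] assms(2) show ?case
    by (intro exI[of _ "\<lambda>j. if j = i then -1 else 0"]) (auto simp: Pi_iff int_pow_neg)
next
  case (eng h1 h2)
  then obtain c d where "h1 = lincomb G e I c" "h2 = lincomb G e I d" by auto
  then show ?case using lincomb_add[OF assms(2)] by metis
qed

text \<open>A positive power of each element of \<open>Y\<close> is a combination of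
  \<open>B\<close>. With more elements in \<open>Y\<close> than in \<open>B\<close>, the exponents
  would form a homogeneous system with more unknowns than equations, and a nontrivial solution would
  be a relation in \<open>Y\<close>.\<close>

lemma zindep_card_le:
  assumes "zindep G Y" "finite B" "B \<subseteq> carrier G" "Y \<subseteq> saturation G (generate G B)"
  shows "card Y \<le> card B"
proof (rule ccontr)
  assume "\<not> card Y \<le> card B"
  then have lt: "card B < card Y" by simp
  have Y: "finite Y" "Y \<subseteq> carrier G" using assms(1) by (auto simp: zindep_def)
  have B: "(\<lambda>x. x) \<in> B \<rightarrow> carrier G" using assms by auto
  have "\<exists>n m. n > (0::nat) \<and> y [^] n = lincomb G (\<lambda>x. x) B m" if "y \<in> Y" for y
  proof -
    have "y \<in> saturation G (generate G B)" using that assms(4) by auto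
    then obtain n :: nat where n: "n > 0" "y [^] n \<in> generate G ((\<lambda>x. x) ` B)"
      by (auto simp: saturation_def)
    then show ?thesis using generate_lincomb[OF assms(2) B n(2)] by blast
  qed
  then obtain n m where nm: "\<And>y. y \<in> Y \<Longrightarrow> n y > (0::nat)"
      "\<And>y. y \<in> Y \<Longrightarrow> y [^] n y = lincomb G (\<lambda>x. x) B (m y)" by metis
  obtain c where c: "\<exists>y\<in>Y. c y \<noteq> 0" "\<And>b. b \<in> B \<Longrightarrow> (\<Sum>y\<in>Y. m y b * c y) = 0"
    using integer_system_nontrivial[OF assms(2) Y(1) lt, of "\<lambda>b y. m y b"] by blast
  \<comment> \<open>The solution \<open>c\<close> relates the powers with exponents
    \<open>n y\<close>; the relation on \<open>Y\<close> itself has coefficients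
    \<open>n y * c y\<close>, still not all zero because \<open>n y > 0\<close>.\<close>
  have "lincomb G (\<lambda>y. y) Y (\<lambda>y. int (n y) * c y) = finprod G (\<lambda>y. lincomb G (\<lambda>x. x) B (\<lambda>b. c y * m y b)) Y"
  proof (rule finprod_cong')
    fix y assume y: "y \<in> Y"
    have "y [^] (int (n y) * c y) = (y [^] n y) [^] c y"
      using y Y by (subst int_pow_pow[symmetric]) (auto simp: int_pow_int)
    then show "y [^] (int (n y) * c y) = lincomb G (\<lambda>x. x) B (\<lambda>b. c y * m y b)"
      using nm(2)[OF y] lincomb_int_pow[OF B] by simp
  qed (use lincomb_closed[OF B] in auto)
  also have "\<dots> = lincomb G (\<lambda>x. x) B (\<lambda>b. \<Sum>y\<in>Y. c y * m y b)"
    by (rule lincomb_sum[OF B Y(1)])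
  also have "\<dots> = \<one>"
    using c(2) by (intro finprod_one_eqI) (auto simp: mult.commute)
  finally have "\<forall>y\<in>Y. int (n y) * c y = 0"
    using assms(1)[unfolded zindep_def, THEN conjunct2, THEN conjunct2, THEN spec, of "\<lambda>y. int (n y) * c y"] by blast
  then show False using c(1) nm(1) by fastforce
qed

section \<open>Saturated subgroups and their free quotients\<close>

lemma saturation_subgroup:
  assumes "subgroup N G" shows "subgroup (saturation G N) G"
proof
  fix x y assume "x \<in> saturation G N" "y \<in> saturation G N"
  then obtain n m :: nat where *: "x \<in> carrier G" "y \<in> carrier G" "n > 0" "m > 0" "x [^] n \<in> N" "y [^] m \<in> N"
    by (auto simp: saturation_def)
  have "(x \<otimes> y) [^] (n * m) = (x [^] n) [^] m \<otimes> (y [^] m) [^] n"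
    using * by (simp add: pow_mult_distrib m_comm nat_pow_pow mult.commute)
  moreover have "\<dots> \<in> N" using * assms
    by (metis subgroup.m_closed subgroup_int_pow_closed int_pow_int)
  ultimately show "x \<otimes> y \<in> saturation G N"
    using * by (auto simp: saturation_def intro!: exI[of _ "n * m"])
next
  fix x assume "x \<in> saturation G N"
  then obtain n :: nat where *: "x \<in> carrier G" "n > 0" "x [^] n \<in> N"
    by (auto simp: saturation_def)
  then show "inv x \<in> saturation G N" using assms
    by (auto simp: saturation_def nat_pow_inv intro!: exI[of _ n] subgroup.m_inv_closed)
qed (use assms in \<open>auto simp: saturation_def subgroup.one_closed intro!: exI[of _ 1]\<close>)

lemma subset_saturation: "N \<subseteq> carrier G \<Longrightarrow> N \<subseteq> saturation G N"
  by (auto simp: saturation_def intro!: exI[of _ 1])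

lemma saturation_idem: "saturation G (saturation G N) \<subseteq> saturation G N"
proof
  fix x assume "x \<in> saturation G (saturation G N)"
  then obtain n m :: nat where "x \<in> carrier G" "n > 0" "m > 0" "(x [^] n) [^] m \<in> N"
    by (auto simp: saturation_def)
  then show "x \<in> saturation G N"
    by (auto simp: saturation_def nat_pow_pow intro!: exI[of _ "n * m"])
qed

lemma saturation_mono: "N \<subseteq> M \<Longrightarrow> saturation G N \<subseteq> saturation G M"
  by (auto simp: saturation_def)

text \<open>Supplies the hypothesis \<open>sat\<close> of \<open>basis_modulo_saturated\<close> when
  \<open>K\<close> is a saturation. A negative exponent is reduced to a positive one by
  inversion.\<close>

lemma saturation_int_pow:
  assumes "subgroup N G" "x \<in> carrier G" "k \<noteq> 0" "x [^] (k::int) \<in> saturation G N"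
  shows "x \<in> saturation G N"
proof -
  have "x [^] (nat \<bar>k\<bar>) \<in> saturation G N"
  proof (cases "k \<ge> 0")
    case True
    then show ?thesis using assms(4) by (simp add: int_pow_int[symmetric])
  next
    case False
    have "inv (x [^] k) \<in> saturation G N"
      using assms(4) saturation_subgroup[OF assms(1)] by (auto intro: subgroup.m_inv_closed)
    with False show ?thesis using assms(2) by (simp add: int_pow_int[symmetric] int_pow_neg)
  qed
  then have "x \<in> saturation G (saturation G N)"
    unfolding saturation_def[of G "saturation G N"] using assms(2,3)
    by (intro CollectI conjI exI[of _ "nat \<bar>k\<bar>"]) auto
  then show ?thesis using saturation_idem by auto
qed

text \<open>An elementary operation on the family is undone by the inverse operation on the
  coefficients. Hence a shear changes neither the elements that are generated nor, up to this change
  of coefficients, the relations.\<close>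

lemma lincomb_shear:
  assumes "finite I" "e \<in> I \<rightarrow> carrier G" "i \<in> I" "j \<in> I" "i \<noteq> j"
  shows "lincomb G (e(j := e j \<otimes> e i [^] s)) I (d(i := d i - s * d j)) = lincomb G e I d"
proof -
  define J where "J = I - {i, j}"
  have J: "I = insert i (insert j J)" "finite J" "i \<notin> insert j J" "j \<notin> J"
    using assms by (auto simp: J_def)
  have ec: "e i \<in> carrier G" "e j \<in> carrier G" "e \<in> J \<rightarrow> carrier G"
    using assms by (auto simp: J_def)
  define P where "P = lincomb G e J d"
  have P: "P \<in> carrier G" unfolding P_def using ec by (intro lincomb_closed)
  have e': "(e(j := e j \<otimes> e i [^] s)) k \<in> carrier G" if "k \<in> I" for k
    using that assms ec by auto
  have eqJ: "lincomb G (e(j := e j \<otimes> e i [^] s)) J (d(i := d i - s * d j)) = P"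
    unfolding P_def using ec J by (intro finprod_cong') auto
  have "lincomb G (e(j := e j \<otimes> e i [^] s)) I (d(i := d i - s * d j)) =
      e i [^] (d i - s * d j) \<otimes> ((e j \<otimes> e i [^] s) [^] d j \<otimes> P)"
    unfolding J(1) using J e' assms(5)
    by (subst finprod_insert, simp, simp, force, force)+ (simp add: eqJ[simplified fun_upd_def] fun_upd_def)
  also have "\<dots> = (e i [^] (d i - s * d j) \<otimes> e i [^] (s * d j)) \<otimes> (e j [^] d j \<otimes> P)"
    using ec P by (simp add: int_pow_distrib int_pow_pow m_ac)
  also have "e i [^] (d i - s * d j) \<otimes> e i [^] (s * d j) = e i [^] d i"
    using ec by (simp add: int_pow_mult[symmetric])
  also have "e i [^] d i \<otimes> (e j [^] d j \<otimes> P) = lincomb G e I d"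
    unfolding J(1) P_def using J ec by (subst finprod_insert, simp, simp, force, force)+ simp
  finally show ?thesis .
qed

text \<open>Among the generating families of least cardinality, a shortest relation is shortened further
  by a Euclidean step on two of its coefficients.\<close>
lemma basis_modulo_saturated:
  assumes "finite X" "X \<subseteq> carrier G" "generate G X = carrier G" "subgroup K G"
    and sat: "\<forall>x\<in>carrier G. \<forall>k::int. k \<noteq> 0 \<longrightarrow> x [^] k \<in> K \<longrightarrow> x \<in> K"
  obtains I :: "nat set" and e where "finite I" "e \<in> I \<rightarrow> carrier G"
    "\<And>x. x \<in> carrier G \<Longrightarrow> \<exists>c. x \<otimes> inv (lincomb G e I c) \<in> K"
    "\<And>c. lincomb G e I c \<in> K \<Longrightarrow> \<forall>i\<in>I. c i = 0"
proof -
  \<comment> \<open>Generation is meant modulo \<open>K\<close>. Indexed families are used instead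
    of sets because a shear may produce repeated elements.\<close>
  define Gen where "Gen = (\<lambda>(I::nat set) e. finite I \<and> e \<in> I \<rightarrow> carrier G \<and>
     (\<forall>x\<in>carrier G. \<exists>c. x \<otimes> inv (lincomb G e I c) \<in> K))"
  have K1: "\<one> \<in> K" using assms(4) by (rule subgroup.one_closed)
  have Kc: "K \<subseteq> carrier G" using assms(4) by (rule subgroup.subset)
  have "\<exists>I e. Gen I e"
  proof -
    obtain f :: "'a \<Rightarrow> nat" where f: "inj_on f X"
      using finite_imp_inj_to_nat_seg[OF assms(1)] by blast
    have im: "inv_into X f ` (f ` X) = X" using f by force
    have car: "inv_into X f \<in> f ` X \<rightarrow> carrier G" using f assms(2) by auto
    have "\<exists>c. x \<otimes> inv (lincomb G (inv_into X f) (f ` X) c) \<in> K" if "x \<in> carrier G" for x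
      using generate_lincomb[of "f ` X" "inv_into X f" x] that im car assms(1,3) K1 by (metis finite_imageI r_inv)
    then have "Gen (f ` X) (inv_into X f)" using car assms(1) by (auto simp: Gen_def)
    then show ?thesis by blast
  qed
  then obtain I0 e0 where "Gen I0 e0" by blast
  then have "\<exists>I e. Gen I e \<and> card I = (LEAST r. \<exists>I e. Gen I e \<and> card I = r)"
    by (intro LeastI_ex[of "\<lambda>r. \<exists>I e. Gen I e \<and> card I = r"]) auto
  then obtain I e where Ie: "Gen I e" "card I = (LEAST r. \<exists>I e. Gen I e \<and> card I = r)" by auto
  have least: "card I \<le> card I'" if "Gen I' e'" for I' e'
    unfolding Ie(2) using that by (intro Least_le) auto
  have fin: "finite I" using Ie by (auto simp: Gen_def)
  \<comment> \<open>The induction on the size of a relation runs over all generating families on the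
    index set \<open>I\<close>, since each shear replaces \<open>e\<close>.\<close>
  have indep: "\<forall>i\<in>I. c i = 0" if "Gen I e" "lincomb G e I c \<in> K" for e c
    using that
  proof (induction "\<Sum>i\<in>I. nat \<bar>c i\<bar>" arbitrary: e c rule: less_induct)
    case less
    have ec: "e \<in> I \<rightarrow> carrier G" using less.prems by (auto simp: Gen_def)
    show ?case
    proof (rule ccontr)
      assume "\<not> ?case"
      then obtain i where i: "i \<in> I" "c i \<noteq> 0" by auto
      show False
      proof (cases "\<forall>j\<in>I. j \<noteq> i \<longrightarrow> c j = 0")
        case True
        have "lincomb G e I c = lincomb G e I (\<lambda>j. if j = i then c i else 0)"
          using True ec by (intro finprod_cong') auto
        then have "e i [^] c i \<in> K" using less.prems lincomb_single[OF ec fin i(1)] by simp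
        then have ei: "e i \<in> K" using sat i ec by (auto simp: Pi_iff)
        have "\<exists>d. x \<otimes> inv (lincomb G e (I - {i}) d) \<in> K" if x: "x \<in> carrier G" for x
        proof -
          obtain d where d: "x \<otimes> inv (lincomb G e I d) \<in> K"
            using less.prems x by (auto simp: Gen_def)
          have c1: "lincomb G e (I - {i}) d \<in> carrier G" using ec by (intro lincomb_closed) auto
          have "lincomb G e (insert i (I - {i})) d = e i [^] d i \<otimes> lincomb G e (I - {i}) d"
            using ec fin i by (intro finprod_insert) auto
          then have "lincomb G e I d = e i [^] d i \<otimes> lincomb G e (I - {i}) d"
            using i by (simp add: insert_absorb)
          then have "x \<otimes> inv (lincomb G e (I - {i}) d) = (x \<otimes> inv (lincomb G e I d)) \<otimes> e i [^] d i"
            using c1 x ei Kc by (simp add: inv_mult_group m_assoc subset_iff)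
          then show ?thesis using d ei assms(4)
            by (metis subgroup.m_closed subgroup_int_pow_closed)
        qed
        then have "Gen (I - {i}) e" using ec fin by (auto simp: Gen_def)
        from least[OF this] show False using card_Diff1_less[OF fin i(1)] by simp
      next
        case False
        then obtain j where j: "j \<in> I" "j \<noteq> i" "c j \<noteq> 0" by auto
        have "\<exists>i j. i \<in> I \<and> j \<in> I \<and> i \<noteq> j \<and> c i \<noteq> 0 \<and> c j \<noteq> 0 \<and> \<bar>c j\<bar> \<le> \<bar>c i\<bar>"
        proof (cases "\<bar>c j\<bar> \<le> \<bar>c i\<bar>")
          case True
          then show ?thesis using i j by (intro exI[of _ i] exI[of _ j]) auto
        next
          case False
          then show ?thesis using i j by (intro exI[of _ j] exI[of _ i]) auto
        qed
        then obtain i j where ij: "i \<in> I" "j \<in> I" "i \<noteq> j" "c i \<noteq> 0" "c j \<noteq> 0" "\<bar>c j\<bar> \<le> \<bar>c i\<bar>" by blast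
        \<comment> \<open>With this sign, subtracting \<open>s * c j\<close> moves
          \<open>c i\<close> towards zero by exactly the absolute value of
          \<open>c j\<close>.\<close>
        define s where "s = sgn (c i) * sgn (c j)"
        define e' where "e' = e(j := e j \<otimes> e i [^] s)"
        define c' where "c' = c(i := c i - s * c j)"
        have small: "\<bar>c i - s * c j\<bar> < \<bar>c i\<bar>"
          using ij by (auto simp: s_def sgn_if abs_if split: if_splits)
        have "(\<Sum>k\<in>I. nat \<bar>c' k\<bar>) < (\<Sum>k\<in>I. nat \<bar>c k\<bar>)"
          by (rule sum_strict_mono_ex1[OF fin]) (use small ij in \<open>auto simp: c'_def intro!: bexI[of _ i]\<close>)
        moreover have "Gen I e'"
        proof -
          have "e' \<in> I \<rightarrow> carrier G" using ec ij by (auto simp: e'_def Pi_iff)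
          moreover have "\<exists>d. x \<otimes> inv (lincomb G e' I d) \<in> K" if x: "x \<in> carrier G" for x
          proof -
            obtain d where d: "x \<otimes> inv (lincomb G e I d) \<in> K"
              using less.prems x by (auto simp: Gen_def)
            then show ?thesis using lincomb_shear[OF fin ec ij(1-3), of s d] unfolding e'_def by metis
          qed
          ultimately show ?thesis using fin by (auto simp: Gen_def)
        qed
        moreover have "lincomb G e' I c' \<in> K"
          using less.prems(2) lincomb_shear[OF fin ec ij(1-3), of s c] by (simp add: e'_def c'_def)
        ultimately have "\<forall>k\<in>I. c' k = 0" by (rule less.hyps)
        \<comment> \<open>The shear leaves the coefficient at \<open>j\<close> unchanged, and that
          one is nonzero.\<close>
        then show False using ij by (auto simp: c'_def)
      qed
    qed
  qed
  show ?thesis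
    by (rule that[of I e]) (use Ie indep in \<open>auto simp: Gen_def\<close>)
qed

text \<open>The functions \<open>c i\<close> are the coordinates of the free quotient by
  \<open>K\<close>, pulled back to the group. Coefficients modulo \<open>K\<close> are unique, so
  each listed property follows by exhibiting coefficients that also represent the element in
  question.\<close>

lemma coordinates_modulo_saturated:
  assumes "finite X" "X \<subseteq> carrier G" "generate G X = carrier G" "subgroup K G"
    and sat: "\<forall>x\<in>carrier G. \<forall>k::int. k \<noteq> 0 \<longrightarrow> x [^] k \<in> K \<longrightarrow> x \<in> K"
  obtains I :: "nat set" and e and c :: "nat \<Rightarrow> 'a \<Rightarrow> int" where "finite I" "e \<in> I \<rightarrow> carrier G"
    "\<And>x. x \<in> carrier G \<Longrightarrow> x \<otimes> inv (lincomb G e I (\<lambda>i. c i x)) \<in> K"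
    "\<And>i x y. i \<in> I \<Longrightarrow> x \<in> carrier G \<Longrightarrow> y \<in> carrier G \<Longrightarrow> c i (x \<otimes> y) = c i x + c i y"
    "\<And>i x. i \<in> I \<Longrightarrow> x \<in> K \<Longrightarrow> c i x = 0"
    "\<And>i j. i \<in> I \<Longrightarrow> j \<in> I \<Longrightarrow> c i (e j) = (if i = j then 1 else 0)"
    "\<And>d. lincomb G e I d \<in> K \<Longrightarrow> \<forall>i\<in>I. d i = 0"
proof -
  obtain I :: "nat set" and e where I: "finite I" "e \<in> I \<rightarrow> carrier G"
    "\<And>x. x \<in> carrier G \<Longrightarrow> \<exists>c. x \<otimes> inv (lincomb G e I c) \<in> K"
    "\<And>c. lincomb G e I c \<in> K \<Longrightarrow> \<forall>i\<in>I. c i = 0"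
    by (rule basis_modulo_saturated[OF assms]) (rule that, assumption+)
  note lc = lincomb_closed[OF I(2)]
  have Kc: "K \<subseteq> carrier G" using assms(4) by (rule subgroup.subset)
  obtain c where c: "\<And>x. x \<in> carrier G \<Longrightarrow> x \<otimes> inv (lincomb G e I (c x)) \<in> K"
    using I(3) by metis
  \<comment> \<open>The difference of two expansions of \<open>x\<close> is a combination lying in
    \<open>K\<close>, so its coefficients vanish.\<close>
  have uniq: "a i = b i" if "x \<in> carrier G" "x \<otimes> inv (lincomb G e I a) \<in> K" "x \<otimes> inv (lincomb G e I b) \<in> K" "i \<in> I"
    for x a b i
  proof -
    have "lincomb G e I (\<lambda>i. a i + - b i) = lincomb G e I a \<otimes> inv (lincomb G e I b)"
      by (simp only: lincomb_add[OF I(2)] lincomb_minus[OF I(2)])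
    also have "\<dots> = inv (x \<otimes> inv (lincomb G e I a)) \<otimes> (x \<otimes> inv (lincomb G e I b))"
    proof -
      have "inv (x \<otimes> inv (lincomb G e I a)) \<otimes> (x \<otimes> inv (lincomb G e I b)) =
          lincomb G e I a \<otimes> ((inv x \<otimes> x) \<otimes> inv (lincomb G e I b))"
        using that(1) lc[of a] lc[of b] by (simp only: inv_mult_group inv_inv inv_closed m_assoc m_closed)
      then show ?thesis using that(1) lc[of a] lc[of b] by simp
    qed
    also have "\<dots> \<in> K"
      using that assms(4) by (metis subgroup.m_closed subgroup.m_inv_closed)
    finally show ?thesis using I(4) that(4) by force
  qed
  show ?thesis
  proof (rule that[of I e "\<lambda>i x. c x i"])
    show "x \<otimes> inv (lincomb G e I (\<lambda>i. c x i)) \<in> K" if "x \<in> carrier G" for x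
      using c[OF that] .
    show "c (x \<otimes> y) i = c x i + c y i" if "i \<in> I" "x \<in> carrier G" "y \<in> carrier G" for i x y
    proof (rule uniq[OF _ c _ that(1)])
      have "(x \<otimes> inv (lincomb G e I (c x))) \<otimes> (y \<otimes> inv (lincomb G e I (c y))) \<in> K"
        using c that assms(4) by (metis subgroup.m_closed)
      also have "(x \<otimes> inv (lincomb G e I (c x))) \<otimes> (y \<otimes> inv (lincomb G e I (c y))) =
        x \<otimes> y \<otimes> inv (lincomb G e I (\<lambda>i. c x i + c y i))"
        using that lc by (simp add: lincomb_add[OF I(2)] inv_mult m_ac)
      finally show "x \<otimes> y \<otimes> inv (lincomb G e I (\<lambda>i. c x i + c y i)) \<in> K" .
    qed (use that in auto)
    show "c x i = 0" if "i \<in> I" "x \<in> K" for i x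
      using that Kc by (intro uniq[OF _ c _ that(1)]) auto
    show "c (e j) i = (if i = j then 1 else 0)" if "i \<in> I" "j \<in> I" for i j
    proof -
      have "lincomb G e I (\<lambda>k. if k = j then 1 else 0) = e j [^] (1::int)"
        using lincomb_single[OF I(2,1) that(2)] .
      then show ?thesis
        using that I(2) assms(4) subgroup.one_closed[OF assms(4)]
        by (intro uniq[OF _ c, of "e j" _ i]) (auto simp: Pi_iff)
    qed
  qed (use I in auto)
qed

section \<open>Rank: independent sets that span up to saturation\<close>

lemma grank_eqI:
  assumes "X \<subseteq> H" "zindep G X" "H \<subseteq> saturation G (generate G X)"
  shows "grank G H = card X"
  unfolding grank_def
proof (rule Max_eqI)
  have X: "finite X" "X \<subseteq> carrier G" using assms(2) by (auto simp: zindep_def)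
  \<comment> \<open>This bound gives the maximality of \<open>card X\<close> and also the finiteness
    of the set of cardinalities, on which the meaning of \<open>Max\<close> depends.\<close>
  have le: "card Y \<le> card X" if "Y \<subseteq> H" "zindep G Y" for Y
    using zindep_card_le[OF that(2) X] that assms(3) by auto
  then have "card ` {Y. Y \<subseteq> H \<and> zindep G Y} \<subseteq> {..card X}" by auto
  then show "finite (card ` {Y. Y \<subseteq> H \<and> zindep G Y})" using finite_subset by blast
  show "y \<le> card X" if "y \<in> card ` {Y. Y \<subseteq> H \<and> zindep G Y}" for y using that le by auto
  show "card X \<in> card ` {Y. Y \<subseteq> H \<and> zindep G Y}" using assms by auto
qed

text \<open>In a relation on \<open>insert h X\<close>, the power of \<open>h\<close> lies in the
  subgroup generated by \<open>X\<close>. As \<open>h\<close> is outside its saturation, the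
  exponent is zero, and what remains is a relation on \<open>X\<close>.\<close>

lemma zindep_insert:
  assumes "zindep G X" "h \<in> carrier G" "h \<notin> saturation G (generate G X)"
  shows "zindep G (insert h X)"
proof -
  have X: "finite X" "X \<subseteq> carrier G" using assms(1) by (auto simp: zindep_def)
  have sg: "subgroup (generate G X) G" using X by (rule_tac generate_is_subgroup)
  have hX: "h \<notin> X"
    using assms(3) subset_saturation[of "generate G X"] subgroup.subset[OF sg] generate.incl[of h X G] by auto
  have "\<forall>x\<in>insert h X. c x = 0" if c: "lincomb G (\<lambda>x. x) (insert h X) c = \<one>" for c
  proof -
    have cl: "lincomb G (\<lambda>x. x) X c \<in> carrier G" using X by (intro lincomb_closed) auto
    have eq: "h [^] c h \<otimes> lincomb G (\<lambda>x. x) X c = \<one>"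
      using c X hX assms(2) by (subst (asm) finprod_insert) auto
    then have "h [^] c h = inv (lincomb G (\<lambda>x. x) X c)"
      using cl assms(2) by (metis inv_equality int_pow_closed)
    moreover have "lincomb G (\<lambda>x. x) X c \<in> generate G X"
      using X sg by (intro lincomb_in_subgroup) (auto intro: generate.incl)
    ultimately have "h [^] c h \<in> generate G X" using sg by (metis subgroup.m_inv_closed)
    then have "h [^] c h \<in> saturation G (generate G X)"
      using subset_saturation[of "generate G X"] subgroup.subset[OF sg] by auto
    then have 0: "c h = 0" using saturation_int_pow[OF sg assms(2)] assms(3) by auto
    then have "lincomb G (\<lambda>x. x) X c = \<one>" using eq cl by simp
    then show ?thesis using 0 assms(1) by (auto simp: zindep_def)
  qed
  then show ?thesis using X assms(2) by (auto simp: zindep_def)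
qed

text \<open>An independent subset of largest size works: an element outside the saturation could be
  added to it by \<open>zindep_insert\<close>. Sizes are bounded by the number of generators of the
  group.\<close>

lemma ex_zindep_spanning:
  assumes "fin_gen G" "H \<subseteq> carrier G"
  obtains X where "X \<subseteq> H" "zindep G X" "H \<subseteq> saturation G (generate G X)"
proof -
  obtain B where B: "finite B" "B \<subseteq> carrier G" "generate G B = carrier G"
    using assms(1) by (auto simp: fin_gen_def)
  have car: "carrier G \<subseteq> saturation G (generate G B)" using subset_saturation[of "carrier G"] B(3) by auto
  define Cs where "Cs = card ` {Y. Y \<subseteq> H \<and> zindep G Y}"
  have "Cs \<subseteq> {..card B}"
    using zindep_card_le[OF _ B(1,2)] car assms(2) unfolding Cs_def by blast
  then have fin: "finite Cs" using finite_subset by blast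
  have "zindep G {}" by (simp add: zindep_def)
  then have "Cs \<noteq> {}" by (auto simp: Cs_def)
  from Max_in[OF fin this] obtain X where X: "X \<subseteq> H" "zindep G X" "card X = Max Cs"
    unfolding Cs_def by auto
  have Xc: "finite X" "X \<subseteq> carrier G" using X(2) by (auto simp: zindep_def)
  have "h \<in> saturation G (generate G X)" if "h \<in> H" for h
  proof (rule ccontr)
    assume n: "h \<notin> saturation G (generate G X)"
    then have z: "zindep G (insert h X)" using zindep_insert[OF X(2)] that assms(2) by auto
    have "h \<notin> X" using n subset_saturation[of "generate G X"] generate_incl[OF Xc(2)] generate.incl[of h X G] by auto
    then have "card (insert h X) = Suc (Max Cs)" using X(3) Xc by simp
    moreover have "card (insert h X) \<in> Cs" using z that X(1) by (auto simp: Cs_def)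
    ultimately show False using Max_ge[OF fin, of "Suc (Max Cs)"] by simp
  qed
  then show ?thesis using that X by blast
qed

lemma grank_generate_le_card:
  assumes "fin_gen G" "finite B" "B \<subseteq> carrier G"
  shows "grank G (generate G B) \<le> card B"
proof -
  obtain X where X: "X \<subseteq> generate G B" "zindep G X" "generate G B \<subseteq> saturation G (generate G X)"
    using ex_zindep_spanning[OF assms(1) generate_incl[OF assms(3)]] .
  show ?thesis unfolding grank_eqI[OF X]
    using zindep_card_le[OF X(2) assms(2,3)] X(1) subset_saturation[OF generate_incl[OF assms(3)]] by auto
qed

lemma grank_mono:
  assumes "fin_gen G" "H \<subseteq> H'" "H' \<subseteq> carrier G"
  shows "grank G H \<le> grank G H'"
proof -
  obtain X where X: "X \<subseteq> H" "zindep G X" "H \<subseteq> saturation G (generate G X)"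
    using ex_zindep_spanning[OF assms(1) subset_trans[OF assms(2,3)]] .
  obtain Y where Y: "Y \<subseteq> H'" "zindep G Y" "H' \<subseteq> saturation G (generate G Y)"
    using ex_zindep_spanning[OF assms(1,3)] .
  have "finite Y" "Y \<subseteq> carrier G" using Y(2) by (auto simp: zindep_def)
  then show ?thesis unfolding grank_eqI[OF X] grank_eqI[OF Y]
    using zindep_card_le[OF X(2)] X(1) Y(3) assms(2) by blast
qed

text \<open>Since saturation is idempotent, an independent set spanning \<open>H\<close> up to
  saturation does the same for \<open>H'\<close>.\<close>

lemma grank_eq_of_saturation:
  assumes "fin_gen G" "H \<subseteq> H'" "H' \<subseteq> saturation G H" "H \<subseteq> carrier G"
  shows "grank G H' = grank G H"
proof -
  obtain X where X: "X \<subseteq> H" "zindep G X" "H \<subseteq> saturation G (generate G X)"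
    using ex_zindep_spanning[OF assms(1,4)] .
  have "H' \<subseteq> saturation G (generate G X)"
    using assms(3) saturation_mono[OF X(3)] saturation_idem[of "generate G X"] by blast
  then show ?thesis using grank_eqI[OF X] grank_eqI[of X H'] X assms(2) by auto
qed

text \<open>Additivity of the rank: an independent set spanning \<open>N\<close> up to saturation,
  joined with lifts of a basis of the quotient by the saturation of \<open>N\<close>, is independent
  and spans the group up to saturation.\<close>

lemma grank_basis:
  assumes "fin_gen G" "subgroup N G" "finite I" "e \<in> I \<rightarrow> carrier G"
    and gen: "\<And>x. x \<in> carrier G \<Longrightarrow> \<exists>c. x \<otimes> inv (lincomb G e I c) \<in> saturation G N"
    and indep: "\<And>c. lincomb G e I c \<in> saturation G N \<Longrightarrow> \<forall>i\<in>I. c i = 0"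
  shows "grank G (carrier G) = grank G N + card I"
proof -
  have Nc: "N \<subseteq> carrier G" using assms(2) by (rule subgroup.subset)
  obtain X where X: "X \<subseteq> N" "zindep G X" "N \<subseteq> saturation G (generate G X)"
    using ex_zindep_spanning[OF assms(1) Nc] .
  have Xc: "finite X" "X \<subseteq> carrier G" using X(2) by (auto simp: zindep_def)
  have NK: "N \<subseteq> saturation G N" using Nc by (rule subset_saturation)
  \<comment> \<open>This and the injectivity of \<open>e\<close> ensure that the union has
    \<open>card X + card I\<close> elements. Either coincidence would give a combination in the
    saturation with a coefficient 1.\<close>
  have nonzero: "e i \<notin> X" if i: "i \<in> I" for i
  proof
    assume "e i \<in> X"
    then have "lincomb G e I (\<lambda>j. if j = i then 1 else 0) \<in> saturation G N"
      using lincomb_single[OF assms(4,3) i, of 1] X(1) NK Xc by (auto simp: int_pow_1 subset_iff)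
    from indep[OF this] i show False by auto
  qed
  have inj: "inj_on e I"
  proof (rule inj_onI, rule ccontr)
    fix i j assume ij: "i \<in> I" "j \<in> I" "e i = e j" "i \<noteq> j"
    have "lincomb G e I (\<lambda>k. (if k = i then 1 else 0) + (if k = j then -1 else 0)) = e i [^] (1::int) \<otimes> e j [^] (-1::int)"
      using ij by (simp only: lincomb_add[OF assms(4)] lincomb_single[OF assms(4,3)])
    also have "\<dots> = \<one>" using ij assms(4) by (auto simp: int_pow_neg Pi_iff)
    finally have "lincomb G e I (\<lambda>k. (if k = i then 1 else 0) + (if k = j then -1 else 0)) \<in> saturation G N"
      using saturation_subgroup[OF assms(2)] subgroup.one_closed by auto
    from indep[OF this] ij show False by auto
  qed
  define Z where "Z = X \<union> e ` I"
  have Z: "finite Z" "Z \<subseteq> carrier G" using Xc assms by (auto simp: Z_def)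
  have disj: "X \<inter> e ` I = {}" using nonzero by auto
  have cardZ: "card Z = card X + card I"
    using disj Xc assms(3) inj by (simp add: Z_def card_Un_disjoint card_image)
  have "\<forall>x\<in>Z. a x = 0" if a: "lincomb G (\<lambda>x. x) Z a = \<one>" for a
  proof -
    have c1: "lincomb G (\<lambda>x. x) X a \<in> N" using assms(2) Xc X(1) by (intro lincomb_in_subgroup) auto
    have c2: "lincomb G e I (\<lambda>i. a (e i)) \<in> carrier G" using assms(4) by (rule lincomb_closed)
    have "lincomb G (\<lambda>x. x) Z a = lincomb G (\<lambda>x. x) X a \<otimes> lincomb G (\<lambda>x. x) (e ` I) a"
      unfolding Z_def using disj Xc assms(3,4) by (intro finprod_Un_disjoint) auto
    also have "lincomb G (\<lambda>x. x) (e ` I) a = lincomb G e I (\<lambda>i. a (e i))"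
      using inj assms(4) by (intro finprod_reindex) auto
    finally have eq: "lincomb G (\<lambda>x. x) X a \<otimes> lincomb G e I (\<lambda>i. a (e i)) = \<one>" using a by simp
    \<comment> \<open>The relation expresses the \<open>e\<close>-part through the
      \<open>X\<close>-part, which lies in \<open>N\<close>. So the coefficients on \<open>e\<close>
      vanish first, and then those on \<open>X\<close>.\<close>
    then have "lincomb G e I (\<lambda>i. a (e i)) = inv (lincomb G (\<lambda>x. x) X a)"
      using c1 c2 Nc by (metis inv_equality inv_inv m_comm subsetD)
    then have "lincomb G e I (\<lambda>i. a (e i)) \<in> saturation G N"
      using c1 NK assms(2) by (metis subgroup.m_inv_closed subsetD)
    then have 0: "\<forall>i\<in>I. a (e i) = 0" by (rule indep)
    then have "lincomb G e I (\<lambda>i. a (e i)) = \<one>" by (intro finprod_one_eqI) auto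
    then have "lincomb G (\<lambda>x. x) X a = \<one>" using eq c1 Nc by (auto simp: subset_iff)
    then have "\<forall>x\<in>X. a x = 0" using X(2) by (auto simp: zindep_def)
    then show ?thesis using 0 by (auto simp: Z_def)
  qed
  then have indZ: "zindep G Z" using Z by (auto simp: zindep_def)
  have sgZ: "subgroup (saturation G (generate G Z)) G"
    using Z by (intro saturation_subgroup generate_is_subgroup)
  have ZZ: "Z \<subseteq> saturation G (generate G Z)"
    using subset_saturation[OF generate_incl[OF Z(2)]] generate.incl[of _ Z G] by blast
  have "x \<in> saturation G (generate G Z)" if x: "x \<in> carrier G" for x
  proof -
    obtain c where c: "x \<otimes> inv (lincomb G e I c) \<in> saturation G N" using gen[OF x] by blast
    have "saturation G N \<subseteq> saturation G (saturation G (generate G X))"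
      using X(3) by (rule saturation_mono)
    also have "\<dots> \<subseteq> saturation G (generate G X)" by (rule saturation_idem)
    also have "\<dots> \<subseteq> saturation G (generate G Z)"
      using Z by (intro saturation_mono mono_generate) (auto simp: Z_def)
    finally have 1: "x \<otimes> inv (lincomb G e I c) \<in> saturation G (generate G Z)" using c by auto
    have 2: "lincomb G e I c \<in> saturation G (generate G Z)"
      using sgZ assms(3) ZZ by (intro lincomb_in_subgroup) (auto simp: Z_def)
    have "x = (x \<otimes> inv (lincomb G e I c)) \<otimes> lincomb G e I c"
      using x lincomb_closed[OF assms(4)] by (simp add: m_assoc)
    then show ?thesis using 1 2 sgZ by (metis subgroup.m_closed)
  qed
  then have "grank G (carrier G) = card Z" using Z indZ by (intro grank_eqI) auto
  then show ?thesis using cardZ grank_eqI[OF X] by simp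
qed

end

subsection \<open>Connected components of annihilators\<close>

lemma one_Ggrp: "\<one>\<^bsub>Ggrp p q F\<^esub> = (\<lambda>_. 1, \<lambda>_. 0, \<one>\<^bsub>F\<^esub>)"
  by (simp add: Ggrp_def)

lemma mult_Ggrp: "g \<otimes>\<^bsub>Ggrp p q F\<^esub> h =
    (\<lambda>i. fst g i * fst h i, \<lambda>i. fst (snd g) i + fst (snd h) i, snd (snd g) \<otimes>\<^bsub>F\<^esub> snd (snd h))"
  by (simp add: Ggrp_def split_beta)

lemma carrier_Ggrp: "g \<in> carrier (Ggrp p q F) \<longleftrightarrow>
    fst g \<in> circ_set p \<and> fst (snd g) \<in> real_set q \<and> snd (snd g) \<in> carrier F"
  by (cases g) (auto simp: Ggrp_def)

lemma circ_set_mult: "u \<in> circ_set p \<Longrightarrow> v \<in> circ_set p \<Longrightarrow> (\<lambda>i. u i * v i) \<in> circ_set p"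
  by (auto simp: circ_set_def norm_mult)

lemma circ_set_nonzero: "u \<in> circ_set p \<Longrightarrow> u i \<noteq> 0"
  by (cases "i < p") (auto simp: circ_set_def)

lemma comm_group_Ggrp:
  assumes "comm_group F" shows "comm_group (Ggrp p q F)"
proof -
  interpret F: comm_group F by fact
  show ?thesis
  proof (rule comm_groupI)
    fix g assume g: "g \<in> carrier (Ggrp p q F)"
    let ?h = "(\<lambda>i. inverse (fst g i), \<lambda>i. - fst (snd g) i, inv\<^bsub>F\<^esub> snd (snd g))"
    have "fst g i \<noteq> 0" for i using g circ_set_nonzero by (auto simp: carrier_Ggrp)
    then have "?h \<otimes>\<^bsub>Ggrp p q F\<^esub> g = \<one>\<^bsub>Ggrp p q F\<^esub>"
      using g by (auto simp: mult_Ggrp one_Ggrp carrier_Ggrp)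
    moreover have "?h \<in> carrier (Ggrp p q F)"
      using g by (auto simp: carrier_Ggrp circ_set_def real_set_def norm_inverse)
    ultimately show "\<exists>h\<in>carrier (Ggrp p q F). h \<otimes>\<^bsub>Ggrp p q F\<^esub> g = \<one>\<^bsub>Ggrp p q F\<^esub>" by blast
  qed (auto simp: carrier_Ggrp mult_Ggrp one_Ggrp circ_set_mult F.m_ac mult_ac add_ac,
       auto simp: circ_set_def real_set_def)
qed

lemma nat_pow_Ggrp:
  "g [^]\<^bsub>Ggrp p q F\<^esub> (n::nat) = (\<lambda>i. fst g i ^ n, \<lambda>i. real n * fst (snd g) i, snd (snd g) [^]\<^bsub>F\<^esub> n)"
  by (induction n) (auto simp: one_Ggrp mult_Ggrp algebra_simps)

lemma hom_Ggrp_snd: "(\<lambda>g. snd (snd g)) \<in> hom (Ggrp p q F) F"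
  by (auto simp: hom_def carrier_Ggrp mult_Ggrp)

lemma Ggrp_torsionD:
  assumes "g [^]\<^bsub>Ggrp p q F\<^esub> (n::nat) = \<one>\<^bsub>Ggrp p q F\<^esub>" "n > 0"
  shows "fst g i ^ n = 1" "fst (snd g) = (\<lambda>_. 0)"
  using assms by (auto simp: nat_pow_Ggrp one_Ggrp fun_eq_iff)

text \<open>A torsion element has zero real part and roots of unity as its circle coordinates, only
  \<open>p\<close> of which are free.\<close>

lemma finite_Ggrp_torsion:
  assumes "finite (carrier F)" "n > (0::nat)"
  shows "finite {g \<in> carrier (Ggrp p q F). g [^]\<^bsub>Ggrp p q F\<^esub> n = \<one>\<^bsub>Ggrp p q F\<^esub>}" (is "finite ?S")
proof -
  define U where "U = {u :: nat \<Rightarrow> complex. \<forall>i. (i \<in> {..<p} \<longrightarrow> u i \<in> {z. z ^ n = 1}) \<and> (i \<notin> {..<p} \<longrightarrow> u i = 1)}"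
  have "finite U" unfolding U_def
    using assms(2) by (intro finite_set_of_finite_funs finite_roots_unity) auto
  moreover have "?S \<subseteq> U \<times> {\<lambda>_. 0} \<times> carrier F"
    using Ggrp_torsionD[OF _ assms(2)] by (auto simp: U_def carrier_Ggrp circ_set_def)
  ultimately show ?thesis using assms(1) by (meson finite_SigmaI finite.intros finite_subset)
qed

text \<open>The counterpart of \<open>Hsub\<close> indexed by a subset of \<Gamma> instead of a list
  of indices; for a subgroup \<open>N\<close> it corresponds to the homomorphisms on the quotient by
  \<open>N\<close>.\<close>

definition annihilator :: "('g, 'b) monoid_scheme \<Rightarrow> nat \<Rightarrow> nat \<Rightarrow> ('f, 'e) monoid_scheme \<Rightarrow> 'g set \<Rightarrow> ('g \<Rightarrow> 'f Gelem) set" where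
  "annihilator \<Gamma> p q F N = {\<phi> \<in> Tspace \<Gamma> p q F. \<forall>x\<in>N. \<phi> x = \<one>\<^bsub>Ggrp p q F\<^esub>}"

text \<open>The product of \<phi> with the homomorphism that \<open>(a, b)\<close> induces through
  the exponential map on the circles and the identity on the real part. The \<open>F\<close>-part
  stays fixed.\<close>

definition twist :: "('g, 'b) monoid_scheme \<Rightarrow> ('g \<Rightarrow> nat \<Rightarrow> real) \<Rightarrow> ('g \<Rightarrow> nat \<Rightarrow> real) \<Rightarrow> ('g \<Rightarrow> 'f Gelem) \<Rightarrow> 'g \<Rightarrow> 'f Gelem" where
  "twist \<Gamma> a b \<phi> = (\<lambda>x\<in>carrier \<Gamma>.
     (\<lambda>j. fst (\<phi> x) j * cis (a x j), \<lambda>j. fst (snd (\<phi> x)) j + b x j, snd (snd (\<phi> x))))"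

locale hom_space = \<Gamma>: comm_group \<Gamma> + F: comm_group F
  for \<Gamma> :: "('g, 'b) monoid_scheme" and F :: "('f, 'e) monoid_scheme" +
  fixes p q :: nat
  assumes fg: "fin_gen \<Gamma>" and finF: "finite (carrier F)" and pq: "p + q > 0"
begin

abbreviation "GG \<equiv> Ggrp p q F"
abbreviation "TT \<equiv> Ttop \<Gamma> p q F"
abbreviation "Ann N \<equiv> annihilator \<Gamma> p q F N"
abbreviation "XX N \<equiv> subtopology TT (Ann N)"

sublocale GG: comm_group GG
  by (rule comm_group_Ggrp) (rule F.comm_group_axioms)

lemma TspaceD:
  assumes "\<phi> \<in> Tspace \<Gamma> p q F"
  shows "\<phi> \<in> hom \<Gamma> GG" "\<phi> \<in> extensional (carrier \<Gamma>)" "x \<in> carrier \<Gamma> \<Longrightarrow> \<phi> x \<in> carrier GG"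
  using assms by (auto simp: Tspace_def homs_def hom_def)

lemma AnnD:
  assumes "\<phi> \<in> Ann N"
  shows "\<phi> \<in> Tspace \<Gamma> p q F" "x \<in> N \<Longrightarrow> \<phi> x = \<one>\<^bsub>GG\<^esub>"
  using assms by (auto simp: annihilator_def)

lemma topspace_Gtop: "topspace (Gtop p q F) = carrier GG"
  by (auto simp: Gtop_def Ggrp_def)

lemma topspace_TT: "topspace TT = Tspace \<Gamma> p q F"
  using TspaceD by (auto simp: Ttop_def topspace_Gtop PiE_def)

lemma topspace_XX: "topspace (XX N) = Ann N"
  by (auto simp: topspace_TT annihilator_def)

lemma component_refl: "\<phi> \<in> Ann N \<Longrightarrow> \<phi> \<in> connected_component_of_set (XX N) \<phi>"
  unfolding mem_Collect_eq connected_component_of_refl topspace_XX .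

text \<open>Additivity of \<open>a\<close> turns into multiplicativity under \<open>cis\<close>. The
  conditions beyond \<open>p\<close> and \<open>q\<close> keep the padding coordinates
  neutral.\<close>

lemma twist_Ann:
  assumes \<phi>: "\<phi> \<in> Ann N" and N: "N \<subseteq> carrier \<Gamma>"
    and add: "\<And>x y j. x \<in> carrier \<Gamma> \<Longrightarrow> y \<in> carrier \<Gamma> \<Longrightarrow> a (x \<otimes>\<^bsub>\<Gamma>\<^esub> y) j = a x j + a y j"
      "\<And>x y j. x \<in> carrier \<Gamma> \<Longrightarrow> y \<in> carrier \<Gamma> \<Longrightarrow> b (x \<otimes>\<^bsub>\<Gamma>\<^esub> y) j = b x j + b y j"
    and N0: "\<And>x j. x \<in> N \<Longrightarrow> a x j = 0" "\<And>x j. x \<in> N \<Longrightarrow> b x j = 0"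
    and pq0: "\<And>x j. j \<ge> p \<Longrightarrow> a x j = 0" "\<And>x j. j \<ge> q \<Longrightarrow> b x j = 0"
  shows "twist \<Gamma> a b \<phi> \<in> Ann N"
proof -
  note T = TspaceD[OF AnnD(1)[OF \<phi>]]
  have "twist \<Gamma> a b \<phi> \<in> hom \<Gamma> GG"
  proof (rule homI)
    fix x assume x: "x \<in> carrier \<Gamma>"
    then show "twist \<Gamma> a b \<phi> x \<in> carrier GG"
      using T(3)[OF x] pq0 by (auto simp: twist_def carrier_Ggrp circ_set_def real_set_def norm_mult)
  next
    fix x y assume x: "x \<in> carrier \<Gamma>" and y: "y \<in> carrier \<Gamma>"
    have "\<phi> (x \<otimes>\<^bsub>\<Gamma>\<^esub> y) = \<phi> x \<otimes>\<^bsub>GG\<^esub> \<phi> y" using T(1) x y by (rule hom_mult)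
    then show "twist \<Gamma> a b \<phi> (x \<otimes>\<^bsub>\<Gamma>\<^esub> y) = twist \<Gamma> a b \<phi> x \<otimes>\<^bsub>GG\<^esub> twist \<Gamma> a b \<phi> y"
      using x y add by (simp add: twist_def mult_Ggrp cis_mult[symmetric] fun_eq_iff)
  qed
  moreover have "twist \<Gamma> a b \<phi> x = \<one>\<^bsub>GG\<^esub>" if "x \<in> N" for x
    using that N N0 AnnD(2)[OF \<phi> that] by (auto simp: twist_def one_Ggrp)
  ultimately show ?thesis
    by (auto simp: annihilator_def Tspace_def homs_def) (auto simp: twist_def)
qed

lemma continuous_map_into_GG:
  assumes "\<And>t. t \<in> S \<Longrightarrow> f t \<in> carrier GG"
    and "\<And>j. continuous_on S (\<lambda>t. fst (f t) j)" "\<And>j. continuous_on S (\<lambda>t. fst (snd (f t)) j)"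
    and "\<And>t. t \<in> S \<Longrightarrow> snd (snd (f t)) = z"
  shows "continuous_map (top_of_set S) (Gtop p q F) f"
proof -
  have "continuous_map (top_of_set S) (top_of_set (circ_set p)) (fst \<circ> f)"
    using assms(1,2) by (auto simp: carrier_Ggrp o_def intro!: continuous_on_coordinatewise_then_product)
  moreover have "continuous_map (top_of_set S) (top_of_set (real_set q)) (fst \<circ> (snd \<circ> f))"
    using assms(1,3) by (auto simp: carrier_Ggrp o_def intro!: continuous_on_coordinatewise_then_product)
  moreover have "continuous_map (top_of_set S) (discrete_topology (carrier F)) (snd \<circ> (snd \<circ> f))"
  proof (cases "S = {}")
    case False
    then have "z \<in> carrier F" using assms(1,4) by (auto simp: carrier_Ggrp)
    then have "continuous_map (top_of_set S) (discrete_topology (carrier F)) (\<lambda>_. z)" by simp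
    then show ?thesis
      by (rule continuous_map_eq) (use assms(4) in auto)
  qed (simp add: continuous_map_def)
  ultimately show ?thesis
    unfolding Gtop_def by (simp add: continuous_map_pairwise)
qed

text \<open>All hypotheses on \<open>a\<close> and \<open>b\<close> are linear, so scaling both by
  \<open>t\<close> in the unit interval gives a path inside the annihilator.\<close>

lemma twist_connected:
  assumes \<phi>: "\<phi> \<in> Ann N" and N: "N \<subseteq> carrier \<Gamma>"
    and add: "\<And>x y j. x \<in> carrier \<Gamma> \<Longrightarrow> y \<in> carrier \<Gamma> \<Longrightarrow> a (x \<otimes>\<^bsub>\<Gamma>\<^esub> y) j = a x j + a y j"
      "\<And>x y j. x \<in> carrier \<Gamma> \<Longrightarrow> y \<in> carrier \<Gamma> \<Longrightarrow> b (x \<otimes>\<^bsub>\<Gamma>\<^esub> y) j = b x j + b y j"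
    and N0: "\<And>x j. x \<in> N \<Longrightarrow> a x j = 0" "\<And>x j. x \<in> N \<Longrightarrow> b x j = 0"
    and pq0: "\<And>x j. j \<ge> p \<Longrightarrow> a x j = 0" "\<And>x j. j \<ge> q \<Longrightarrow> b x j = 0"
  shows "connected_component_of (XX N) \<phi> (twist \<Gamma> a b \<phi>)"
proof -
  note T = TspaceD[OF AnnD(1)[OF \<phi>]]
  define g where "g = (\<lambda>t::real. twist \<Gamma> (\<lambda>x j. t * a x j) (\<lambda>x j. t * b x j) \<phi>)"
  have gA: "g t \<in> Ann N" for t
    unfolding g_def using assms by (intro twist_Ann) (auto simp: algebra_simps)
  have gc: "g t x \<in> carrier GG" if "x \<in> carrier \<Gamma>" for t x
    using TspaceD(3)[OF AnnD(1)[OF gA] that] .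
  have "continuous_map (top_of_set {0..1}) (Gtop p q F) (\<lambda>t. g t x)" if x: "x \<in> carrier \<Gamma>" for x
    using gc[OF x]
    by (rule continuous_map_into_GG[where z = "snd (snd (\<phi> x))"])
       (use x in \<open>auto simp: g_def twist_def cis_conv_exp intro!: continuous_intros\<close>)
  moreover have "g ` {0..1} \<subseteq> extensional (carrier \<Gamma>)" by (auto simp: g_def twist_def)
  ultimately have "continuous_map (top_of_set {0..1}) (product_topology (\<lambda>_. Gtop p q F) (carrier \<Gamma>)) g"
    by (auto simp: continuous_map_componentwise)
  then have cg: "continuous_map (top_of_set {0..1}) (XX N) g"
    unfolding Ttop_def using gA AnnD(1) by (auto simp: continuous_map_in_subtopology)
  have "connectedin (XX N) (g ` {0..1})"
    by (rule connectedin_continuous_map_image[OF cg]) (simp add: connectedin_subtopology)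
  moreover have "g 0 = \<phi>"
    using T(2) by (auto simp: g_def twist_def fun_eq_iff extensional_def)
  moreover have "g 1 = twist \<Gamma> a b \<phi>" by (simp add: g_def)
  ultimately show ?thesis
    unfolding connected_component_of_def by (intro exI[of _ "g ` {0..1}"]) (auto intro: rev_image_eqI[of 0] rev_image_eqI[of 1])
qed

text \<open>Evaluation at a point of \<Gamma> is continuous. On a connected set the discrete
  \<open>F\<close>-part is therefore constant; at a point of the saturation the circle coordinates
  run through finitely many roots of unity, hence are constant too, and the real part is
  zero.\<close>

lemma connected_component_imp_agree:
  assumes "connected_component_of (XX N) \<phi> \<psi>" "N \<subseteq> carrier \<Gamma>"
  shows "\<And>x. x \<in> saturation \<Gamma> N \<Longrightarrow> \<phi> x = \<psi> x"
    and "\<And>x. x \<in> carrier \<Gamma> \<Longrightarrow> snd (snd (\<phi> x)) = snd (snd (\<psi> x))"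
proof -
  obtain C where C: "connectedin (XX N) C" "\<phi> \<in> C" "\<psi> \<in> C"
    using assms(1) by (auto simp: connected_component_of_def)
  have CA: "C \<subseteq> Ann N" using connectedin_subset_topspace[OF C(1)] by (simp add: topspace_XX)
  have Cc: "connectedin (product_topology (\<lambda>_. Gtop p q F) (carrier \<Gamma>)) C"
    using C(1) by (simp add: Ttop_def connectedin_subtopology)
  have cG: "continuous_map (product_topology (\<lambda>_. Gtop p q F) (carrier \<Gamma>)) (Gtop p q F) (\<lambda>\<phi>. \<phi> x)"
    if "x \<in> carrier \<Gamma>" for x using that by (rule continuous_map_product_projection)
  have cF: "continuous_map (Gtop p q F) (discrete_topology (carrier F)) (\<lambda>g. snd (snd g))"
    unfolding Gtop_def using continuous_map_compose[OF continuous_map_snd continuous_map_snd] by (simp add: o_def)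
  have cS: "continuous_map (Gtop p q F) euclidean (\<lambda>g. fst g j)" for j
  proof -
    have 1: "continuous_map (Gtop p q F) (top_of_set (circ_set p)) fst"
      unfolding Gtop_def by (rule continuous_map_fst)
    have 2: "continuous_map (top_of_set (circ_set p)) euclidean (\<lambda>u. u j)"
      by (auto intro!: continuous_on_subset[OF continuous_on_product_coordinates])
    show ?thesis using continuous_map_compose[OF 1 2] by (simp add: o_def)
  qed
  show F: "snd (snd (\<phi> x)) = snd (snd (\<psi> x))" if x: "x \<in> carrier \<Gamma>" for x
  proof -
    have "connectedin (discrete_topology (carrier F)) (((\<lambda>g. snd (snd g)) \<circ> (\<lambda>\<phi>. \<phi> x)) ` C)"
      by (rule connectedin_continuous_map_image[OF continuous_map_compose[OF cG[OF x] cF] Cc])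
    then obtain z where "((\<lambda>g. snd (snd g)) \<circ> (\<lambda>\<phi>. \<phi> x)) ` C \<subseteq> {z}"
      unfolding connectedin_discrete_topology by blast
    then show ?thesis using C(2,3) by auto
  qed
  show "\<phi> x = \<psi> x" if x: "x \<in> saturation \<Gamma> N" for x
  proof -
    obtain n :: nat where n: "n > 0" "x [^]\<^bsub>\<Gamma>\<^esub> n \<in> N" and xc: "x \<in> carrier \<Gamma>"
      using x by (auto simp: saturation_def)
    have tor: "\<eta> x [^]\<^bsub>GG\<^esub> n = \<one>\<^bsub>GG\<^esub>" if "\<eta> \<in> C" for \<eta>
    proof -
      have \<eta>: "\<eta> \<in> Ann N" using that CA by auto
      have "\<eta> x [^]\<^bsub>GG\<^esub> n = \<eta> (x [^]\<^bsub>\<Gamma>\<^esub> n)"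
        using hom_nat_pow[OF TspaceD(1)[OF AnnD(1)[OF \<eta>]]] xc \<Gamma>.is_group GG.is_group by metis
      then show ?thesis using AnnD(2)[OF \<eta>] n by simp
    qed
    have "fst (\<phi> x) j = fst (\<psi> x) j" for j
    proof -
      have "connectedin euclidean (((\<lambda>g. fst g j) \<circ> (\<lambda>\<phi>. \<phi> x)) ` C)"
        by (rule connectedin_continuous_map_image[OF continuous_map_compose[OF cG[OF xc] cS] Cc])
      then have con: "connected (((\<lambda>g. fst g j) \<circ> (\<lambda>\<phi>. \<phi> x)) ` C)" by simp
      have roots: "((\<lambda>g. fst g j) \<circ> (\<lambda>\<phi>. \<phi> x)) ` C \<subseteq> {z. z ^ n = 1}"
        using Ggrp_torsionD(1)[OF tor n(1)] by auto
      from roots have "finite (((\<lambda>g. fst g j) \<circ> (\<lambda>\<phi>. \<phi> x)) ` C)"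
        by (rule finite_subset) (use finite_roots_unity n(1) in auto)
      then obtain z where "((\<lambda>g. fst g j) \<circ> (\<lambda>\<phi>. \<phi> x)) ` C \<subseteq> {z}"
        using connected_finite_iff_sing[OF con] by auto
      then show ?thesis using C(2,3) by auto
    qed
    moreover have "fst (snd (\<phi> x)) = fst (snd (\<psi> x))"
      using Ggrp_torsionD(2)[OF tor n(1)] C(2,3) by metis
    ultimately show ?thesis using F[OF xc] by (simp add: prod_eq_iff fun_eq_iff)
  qed
qed

end

lemma hom_eq_on_generate:
  assumes "group G" "group H" "h \<in> hom G H" "h' \<in> hom G H" "X \<subseteq> carrier G"
    "\<And>x. x \<in> X \<Longrightarrow> h x = h' x" "x \<in> generate G X"
  shows "h x = h' x"
proof -
  interpret h: group_hom G H h using assms by (simp add: group_hom_def group_hom_axioms_def)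
  interpret h': group_hom G H h' using assms by (simp add: group_hom_def group_hom_axioms_def)
  show ?thesis using assms(7)
  proof (induction rule: generate.induct)
    case one then show ?case by simp
  next
    case (incl x) then show ?case using assms(6) by simp
  next
    case (inv x)
    then show ?case using assms(5) assms(6)[OF inv.hyps] by (metis h.hom_inv h'.hom_inv subsetD)
  next
    case (eng x y)
    then show ?case using group.generate_in_carrier[OF assms(1,5)] by simp
  qed
qed

section \<open>Splitting \<Gamma> into a saturated subgroup and a free complement\<close>

locale hom_subspace = hom_space \<Gamma> F p q
  for \<Gamma> :: "('g, 'b) monoid_scheme" and F :: "('f, 'e) monoid_scheme" and p q :: nat +
  fixes N :: "'g set" and I :: "nat set" and e :: "nat \<Rightarrow> 'g" and c :: "nat \<Rightarrow> 'g \<Rightarrow> int"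
  assumes subN: "subgroup N \<Gamma>" and finI: "finite I" and eI: "e \<in> I \<rightarrow> carrier \<Gamma>"
    and cK: "\<And>x. x \<in> carrier \<Gamma> \<Longrightarrow> x \<otimes>\<^bsub>\<Gamma>\<^esub> inv\<^bsub>\<Gamma>\<^esub> (lincomb \<Gamma> e I (\<lambda>i. c i x)) \<in> saturation \<Gamma> N"
    and c_add: "\<And>i x y. i \<in> I \<Longrightarrow> x \<in> carrier \<Gamma> \<Longrightarrow> y \<in> carrier \<Gamma> \<Longrightarrow> c i (x \<otimes>\<^bsub>\<Gamma>\<^esub> y) = c i x + c i y"
    and c_0: "\<And>i x. i \<in> I \<Longrightarrow> x \<in> saturation \<Gamma> N \<Longrightarrow> c i x = 0"
    and c_e: "\<And>i j. i \<in> I \<Longrightarrow> j \<in> I \<Longrightarrow> c i (e j) = (if i = j then 1 else 0)"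
begin

abbreviation "K \<equiv> saturation \<Gamma> N"

text \<open>The projection onto \<open>K\<close> along the span of \<open>e\<close>. Composing with
  it extends homomorphisms from \<open>K\<close> to \<Gamma>.\<close>

definition proj :: "'g \<Rightarrow> 'g" where
  "proj x = x \<otimes>\<^bsub>\<Gamma>\<^esub> inv\<^bsub>\<Gamma>\<^esub> (lincomb \<Gamma> e I (\<lambda>i. c i x))"

lemma N_carrier: "N \<subseteq> carrier \<Gamma>"
  using subN by (rule subgroup.subset)

lemma K_carrier: "K \<subseteq> carrier \<Gamma>"
  by (auto simp: saturation_def)

lemma N_subset_K: "N \<subseteq> K"
  using N_carrier by (rule \<Gamma>.subset_saturation)

lemma subK: "subgroup K \<Gamma>"
  using subN by (rule \<Gamma>.saturation_subgroup)

lemma lc_closed: "lincomb \<Gamma> e I d \<in> carrier \<Gamma>"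
  using eI by (rule \<Gamma>.lincomb_closed)

lemma proj_K: "x \<in> carrier \<Gamma> \<Longrightarrow> proj x \<in> K"
  unfolding proj_def by (rule cK)

lemma proj_decomp: "x \<in> carrier \<Gamma> \<Longrightarrow> x = proj x \<otimes>\<^bsub>\<Gamma>\<^esub> lincomb \<Gamma> e I (\<lambda>i. c i x)"
  using lc_closed by (simp add: proj_def \<Gamma>.m_assoc)

lemma proj_mult:
  assumes "x \<in> carrier \<Gamma>" "y \<in> carrier \<Gamma>"
  shows "proj (x \<otimes>\<^bsub>\<Gamma>\<^esub> y) = proj x \<otimes>\<^bsub>\<Gamma>\<^esub> proj y"
proof -
  have "lincomb \<Gamma> e I (\<lambda>i. c i (x \<otimes>\<^bsub>\<Gamma>\<^esub> y)) = lincomb \<Gamma> e I (\<lambda>i. c i x + c i y)"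
    using eI c_add assms by (intro \<Gamma>.finprod_cong') (auto simp: Pi_iff)
  also have "\<dots> = lincomb \<Gamma> e I (\<lambda>i. c i x) \<otimes>\<^bsub>\<Gamma>\<^esub> lincomb \<Gamma> e I (\<lambda>i. c i y)"
    by (rule \<Gamma>.lincomb_add[OF eI])
  finally show ?thesis
    using assms lc_closed by (simp add: proj_def \<Gamma>.inv_mult \<Gamma>.m_ac)
qed

lemma proj_on_K: "x \<in> K \<Longrightarrow> proj x = x"
proof -
  assume x: "x \<in> K"
  have "lincomb \<Gamma> e I (\<lambda>i. c i x) = \<one>\<^bsub>\<Gamma>\<^esub>"
    using c_0[OF _ x] by (intro \<Gamma>.finprod_one_eqI) auto
  then show ?thesis using x K_carrier by (auto simp: proj_def subset_iff)
qed

lemma lc_e: "i \<in> I \<Longrightarrow> lincomb \<Gamma> e I (\<lambda>j. c j (e i)) = e i"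
proof -
  assume i: "i \<in> I"
  have "lincomb \<Gamma> e I (\<lambda>j. c j (e i)) = lincomb \<Gamma> e I (\<lambda>j. if j = i then 1 else 0)"
    using eI c_e i by (intro \<Gamma>.finprod_cong') (auto simp: Pi_iff)
  also have "\<dots> = e i [^]\<^bsub>\<Gamma>\<^esub> (1::int)" by (rule \<Gamma>.lincomb_single[OF eI finI i])
  finally show ?thesis using eI i by (auto simp: Pi_iff)
qed

lemma proj_e: "i \<in> I \<Longrightarrow> proj (e i) = \<one>\<^bsub>\<Gamma>\<^esub>"
  using lc_e eI by (auto simp: proj_def Pi_iff)

text \<open>By \<open>proj_decomp\<close>, \<Gamma> is generated by \<open>K\<close> and the family
  \<open>e\<close>.\<close>

lemma hom_eqI:
  assumes "comm_group H" "h \<in> hom \<Gamma> H" "h' \<in> hom \<Gamma> H"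
    "\<And>x. x \<in> K \<Longrightarrow> h x = h' x" "\<And>i. i \<in> I \<Longrightarrow> h (e i) = h' (e i)" "x \<in> carrier \<Gamma>"
  shows "h x = h' x"
proof -
  interpret H: comm_group H by fact
  have pc: "proj x \<in> carrier \<Gamma>" using proj_K[OF assms(6)] K_carrier by auto
  have h: "h'' x = h'' (proj x) \<otimes>\<^bsub>H\<^esub> lincomb H (\<lambda>i. h'' (e i)) I (\<lambda>i. c i x)" if "h'' \<in> hom \<Gamma> H" for h''
  proof -
    have "h'' x = h'' (proj x \<otimes>\<^bsub>\<Gamma>\<^esub> lincomb \<Gamma> e I (\<lambda>i. c i x))" using proj_decomp[OF assms(6)] by simp
    also have "\<dots> = h'' (proj x) \<otimes>\<^bsub>H\<^esub> h'' (lincomb \<Gamma> e I (\<lambda>i. c i x))"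
      using that pc lc_closed by (intro hom_mult)
    finally show ?thesis using \<Gamma>.hom_lincomb[OF assms(1) that finI eI] by simp
  qed
  have "lincomb H (\<lambda>i. h (e i)) I (\<lambda>i. c i x) = lincomb H (\<lambda>i. h' (e i)) I (\<lambda>i. c i x)"
    using assms(3,5) eI by (intro H.finprod_cong') (auto simp: hom_def Pi_iff)
  then show ?thesis using h[OF assms(2)] h[OF assms(3)] assms(4) proj_K[OF assms(6)] by simp
qed

text \<open>The quotient of the two homomorphisms factors through the free group \<open>\<Gamma>/K\<close>, so it lifts along
  the exponential map; scaling the lift gives a path.\<close>
lemma agree_imp_connected_component:
  assumes \<phi>: "\<phi> \<in> Ann N" and \<psi>: "\<psi> \<in> Ann N"
    and K: "\<And>x. x \<in> K \<Longrightarrow> \<phi> x = \<psi> x"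
    and FF: "\<And>x. x \<in> carrier \<Gamma> \<Longrightarrow> snd (snd (\<phi> x)) = snd (snd (\<psi> x))"
  shows "connected_component_of (XX N) \<phi> \<psi>"
proof -
  note T\<phi> = TspaceD[OF AnnD(1)[OF \<phi>]] and T\<psi> = TspaceD[OF AnnD(1)[OF \<psi>]]
  \<comment> \<open>On each basis element, \<theta> is an angle that carries the circle coordinate
    of \<phi> to that of \<psi>, and \<rho> is the difference of the real coordinates.\<close>
  define \<theta> where "\<theta> i j = Arg (fst (\<psi> (e i)) j / fst (\<phi> (e i)) j)" for i j
  define \<rho> where "\<rho> i j = fst (snd (\<psi> (e i))) j - fst (snd (\<phi> (e i))) j" for i j
  \<comment> \<open>Extension along the coordinates makes \<open>a\<close> and \<open>b\<close>
    additive, and they vanish on \<open>K\<close> because the coordinates do.\<close>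
  define a where "a = (\<lambda>x j. \<Sum>i\<in>I. of_int (c i x) * \<theta> i j)"
  define b where "b = (\<lambda>x j. \<Sum>i\<in>I. of_int (c i x) * \<rho> i j)"
  have G: "\<phi> (e i) \<in> carrier GG" "\<psi> (e i) \<in> carrier GG" if "i \<in> I" for i
    using that eI T\<phi>(3) T\<psi>(3) by (auto simp: Pi_iff)
  have \<theta>0: "\<theta> i j = 0" if "i \<in> I" "j \<ge> p" for i j
    using G[OF that(1)] that(2) by (simp add: \<theta>_def carrier_Ggrp circ_set_def)
  have \<rho>0: "\<rho> i j = 0" if "i \<in> I" "j \<ge> q" for i j
    using G[OF that(1)] that(2) by (simp add: \<rho>_def carrier_Ggrp real_set_def)
  have cis: "fst (\<phi> (e i)) j * cis (\<theta> i j) = fst (\<psi> (e i)) j" if "i \<in> I" for i j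
  proof -
    have n: "cmod (fst (\<psi> (e i)) j) = 1" "cmod (fst (\<phi> (e i)) j) = 1"
      using G[OF that] by (cases "j < p"; auto simp: carrier_Ggrp circ_set_def)+
    then have "fst (\<psi> (e i)) j / fst (\<phi> (e i)) j \<noteq> 0" by auto
    then have "cis (\<theta> i j) = fst (\<psi> (e i)) j / fst (\<phi> (e i)) j"
      unfolding \<theta>_def using n by (subst cis_Arg) (auto simp: sgn_div_norm norm_divide)
    then show ?thesis using n by auto
  qed
  have hyps: "\<And>x y j. x \<in> carrier \<Gamma> \<Longrightarrow> y \<in> carrier \<Gamma> \<Longrightarrow> a (x \<otimes>\<^bsub>\<Gamma>\<^esub> y) j = a x j + a y j"
      "\<And>x y j. x \<in> carrier \<Gamma> \<Longrightarrow> y \<in> carrier \<Gamma> \<Longrightarrow> b (x \<otimes>\<^bsub>\<Gamma>\<^esub> y) j = b x j + b y j"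
      "\<And>x j. x \<in> N \<Longrightarrow> a x j = 0" "\<And>x j. x \<in> N \<Longrightarrow> b x j = 0"
      "\<And>x j. j \<ge> p \<Longrightarrow> a x j = 0" "\<And>x j. j \<ge> q \<Longrightarrow> b x j = 0"
    using N_subset_K c_0 \<theta>0 \<rho>0
    by (auto simp: a_def b_def c_add ring_distribs subset_iff simp flip: sum.distrib)
  have tw: "connected_component_of (XX N) \<phi> (twist \<Gamma> a b \<phi>)"
    using twist_connected[OF \<phi> N_carrier hyps] .
  have twA: "twist \<Gamma> a b \<phi> \<in> Ann N"
    using twist_Ann[OF \<phi> N_carrier hyps] .
  \<comment> \<open>By \<open>hom_eqI\<close> it is enough to compare on \<open>K\<close>, where the
    twist is trivial, and on \<open>e\<close>, where \<theta> and \<rho> were chosen to fit.\<close>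
  have "twist \<Gamma> a b \<phi> = \<psi>"
  proof (rule extensionalityI)
    fix x assume x: "x \<in> carrier \<Gamma>"
    show "twist \<Gamma> a b \<phi> x = \<psi> x"
    proof (rule hom_eqI[OF GG.comm_group_axioms TspaceD(1)[OF AnnD(1)[OF twA]] T\<psi>(1) _ _ x])
      fix x assume x: "x \<in> K"
      then have "a x = (\<lambda>j. 0)" "b x = (\<lambda>j. 0)" using c_0 by (auto simp: a_def b_def)
      then show "twist \<Gamma> a b \<phi> x = \<psi> x" using x K K_carrier by (auto simp: twist_def)
    next
      fix i assume i: "i \<in> I"
      have "a (e i) j = (\<Sum>k\<in>I. if k = i then \<theta> i j else 0)" for j
        unfolding a_def using i by (intro sum.cong) (auto simp: c_e)
      then have 1: "a (e i) j = \<theta> i j" for j using i finI by simp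
      have "b (e i) j = (\<Sum>k\<in>I. if k = i then \<rho> i j else 0)" for j
        unfolding b_def using i by (intro sum.cong) (auto simp: c_e)
      then have 2: "b (e i) j = \<rho> i j" for j using i finI by simp
      have "e i \<in> carrier \<Gamma>" using i eI by auto
      then show "twist \<Gamma> a b \<phi> (e i) = \<psi> (e i)"
        using 1 2 cis[OF i] FF by (simp add: twist_def prod_eq_iff \<rho>_def)
    qed
  qed (use T\<psi>(2) in \<open>auto simp: twist_def\<close>)
  then show ?thesis using tw by simp
qed

lemma connected_component_iff:
  "connected_component_of (XX N) \<phi> \<psi> \<longleftrightarrow> \<phi> \<in> Ann N \<and> \<psi> \<in> Ann N \<and> (\<forall>x\<in>K. \<phi> x = \<psi> x) \<and>
     (\<forall>x\<in>carrier \<Gamma>. snd (snd (\<phi> x)) = snd (snd (\<psi> x)))"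
proof
  assume C: "connected_component_of (XX N) \<phi> \<psi>"
  then show "\<phi> \<in> Ann N \<and> \<psi> \<in> Ann N \<and> (\<forall>x\<in>K. \<phi> x = \<psi> x) \<and>
     (\<forall>x\<in>carrier \<Gamma>. snd (snd (\<phi> x)) = snd (snd (\<psi> x)))"
    using connected_component_imp_agree[OF C N_carrier] connected_component_of_equiv[of "XX N" \<phi> \<psi>]
    by (auto simp: topspace_XX)
qed (auto intro: agree_imp_connected_component)

text \<open>Outside \<open>K\<close> some coordinate of \<open>x\<close> is nonzero. A twist along
  this coordinate stays in the component but changes the value at \<open>x\<close>.\<close>

lemma component_vanishing_imp_saturation:
  assumes C: "C \<in> connected_components_of (XX N)" and x: "x \<in> carrier \<Gamma>"
    and van: "\<And>\<phi>. \<phi> \<in> C \<Longrightarrow> \<phi> x = \<one>\<^bsub>GG\<^esub>"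
  shows "x \<in> K"
proof (rule ccontr)
  assume nK: "x \<notin> K"
  obtain \<phi> where \<phi>: "\<phi> \<in> Ann N" "C = connected_component_of_set (XX N) \<phi>"
    using C by (auto simp: connected_components_of_def topspace_XX)
  have "\<exists>i\<in>I. c i x \<noteq> 0"
  proof (rule ccontr)
    assume "\<not> ?thesis"
    then have "lincomb \<Gamma> e I (\<lambda>i. c i x) = \<one>\<^bsub>\<Gamma>\<^esub>" by (intro \<Gamma>.finprod_one_eqI) auto
    then show False using proj_decomp[OF x] proj_K[OF x] nK K_carrier by (auto simp: subset_iff)
  qed
  then obtain i where i: "i \<in> I" "c i x \<noteq> 0" by auto
  \<comment> \<open>The scaling gives \<open>a x 0 = pi\<close>, so the circle coordinate is
    multiplied by -1; similarly \<open>b x 0\<close> is the nonzero integer \<open>c i x\<close>. As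
    \<open>p + q > 0\<close>, at least one of the two coordinates exists.\<close>
  define a where "a = (\<lambda>y j. if p > 0 \<and> j = (0::nat) then of_int (c i y) * (pi / of_int (c i x)) else 0)"
  define b where "b = (\<lambda>y j. if q > 0 \<and> j = (0::nat) then (of_int (c i y) :: real) else 0)"
  have "connected_component_of (XX N) \<phi> (twist \<Gamma> a b \<phi>)"
    using i N_subset_K by (intro twist_connected[OF \<phi>(1) N_carrier])
      (auto simp: a_def b_def c_add c_0 ring_distribs subset_iff add_divide_distrib)
  then have "twist \<Gamma> a b \<phi> x = \<one>\<^bsub>GG\<^esub>" using van \<phi>(2) by auto
  moreover have "\<phi> x = \<one>\<^bsub>GG\<^esub>" using van \<phi> component_refl by simp
  ultimately have "(\<lambda>j. cis (a x j)) = (\<lambda>_. 1)" "b x = (\<lambda>_. 0)"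
    using x by (auto simp: twist_def one_Ggrp)
  then have "cis (a x 0) = 1" "b x 0 = 0" by (metis, metis)
  then show False using pq i(2) by (auto simp: a_def b_def split: if_splits)
qed

subsection \<open>Counting the components\<close>

lemma normalN: "N \<lhd> \<Gamma>"
  using subN by (simp add: \<Gamma>.normal_iff_subgroup)

lemma coset_eq_N_iff: "x \<in> carrier \<Gamma> \<Longrightarrow> N #>\<^bsub>\<Gamma>\<^esub> x = N \<longleftrightarrow> x \<in> N"
  using \<Gamma>.coset_join1[OF _ _ subN] \<Gamma>.coset_join2[OF _ subN] N_carrier by auto

lemma coset_N: "x \<in> N \<Longrightarrow> N #>\<^bsub>\<Gamma>\<^esub> x = N"
  using coset_eq_N_iff N_carrier by auto

text \<open>Connects the torsion of the quotient, which defines the multiplicity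
  \<open>m(S;G)\<close>, with the subgroup \<open>K\<close> on which components are
  distinguished.\<close>

lemma tor_set_FactGroup: "tor_set (\<Gamma> Mod N) = (\<lambda>x. N #>\<^bsub>\<Gamma>\<^esub> x) ` K"
proof -
  have "(N #>\<^bsub>\<Gamma>\<^esub> x) [^]\<^bsub>\<Gamma> Mod N\<^esub> n = \<one>\<^bsub>\<Gamma> Mod N\<^esub> \<longleftrightarrow> x [^]\<^bsub>\<Gamma>\<^esub> n \<in> N" if "x \<in> carrier \<Gamma>" for x and n :: nat
    using normal.FactGroup_pow[OF normalN that, of n] coset_eq_N_iff that by simp
  then show ?thesis by (auto simp: tor_set_def saturation_def carrier_FactGroup)
qed

lemma coset_mult:
  "x \<in> carrier \<Gamma> \<Longrightarrow> y \<in> carrier \<Gamma> \<Longrightarrow>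
    (N #>\<^bsub>\<Gamma>\<^esub> x) \<otimes>\<^bsub>\<Gamma> Mod N\<^esub> (N #>\<^bsub>\<Gamma>\<^esub> y) = N #>\<^bsub>\<Gamma>\<^esub> (x \<otimes>\<^bsub>\<Gamma>\<^esub> y)"
  by (simp add: normal.rcos_sum[OF normalN])

abbreviation "torhoms \<equiv> homs (tor_group (\<Gamma> Mod N)) GG"

lemma torhoms_hom:
  assumes "h \<in> torhoms"
  shows "(\<lambda>x. h (N #>\<^bsub>\<Gamma>\<^esub> proj x)) \<in> hom \<Gamma> GG"
proof (rule homI)
  have h: "h \<in> hom (tor_group (\<Gamma> Mod N)) GG" using assms by (simp add: homs_def)
  have inT: "N #>\<^bsub>\<Gamma>\<^esub> proj x \<in> carrier (tor_group (\<Gamma> Mod N))" if "x \<in> carrier \<Gamma>" for x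
    using proj_K[OF that] by (simp add: tor_group_def tor_set_FactGroup)
  show "h (N #>\<^bsub>\<Gamma>\<^esub> proj x) \<in> carrier GG" if "x \<in> carrier \<Gamma>" for x
    using h inT[OF that] by (auto simp: hom_def)
  show "h (N #>\<^bsub>\<Gamma>\<^esub> proj (x \<otimes>\<^bsub>\<Gamma>\<^esub> y)) = h (N #>\<^bsub>\<Gamma>\<^esub> proj x) \<otimes>\<^bsub>GG\<^esub> h (N #>\<^bsub>\<Gamma>\<^esub> proj y)"
    if xy: "x \<in> carrier \<Gamma>" "y \<in> carrier \<Gamma>" for x y
  proof -
    have "h ((N #>\<^bsub>\<Gamma>\<^esub> proj x) \<otimes>\<^bsub>\<Gamma> Mod N\<^esub> (N #>\<^bsub>\<Gamma>\<^esub> proj y)) = h (N #>\<^bsub>\<Gamma>\<^esub> proj x) \<otimes>\<^bsub>GG\<^esub> h (N #>\<^bsub>\<Gamma>\<^esub> proj y)"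
      using hom_mult[OF h inT inT, OF xy] by (simp add: tor_group_def)
    moreover have "proj x \<in> carrier \<Gamma>" "proj y \<in> carrier \<Gamma>" using proj_K K_carrier xy by auto
    ultimately show ?thesis using proj_mult[OF xy] coset_mult by simp
  qed
qed

lemma torhoms_eqI:
  assumes "h \<in> torhoms" "h' \<in> torhoms" "\<And>x. x \<in> K \<Longrightarrow> h (N #>\<^bsub>\<Gamma>\<^esub> x) = h' (N #>\<^bsub>\<Gamma>\<^esub> x)"
  shows "h = h'"
  using assms by (intro extensionalityI[of h "tor_set (\<Gamma> Mod N)" h'])
    (auto simp: homs_def tor_group_def tor_set_FactGroup)

text \<open>A homomorphism on the torsion is determined by its values at the projections of finitely
  many generators of \<Gamma>. Each value is a torsion element of bounded order, so only finitely
  many values occur.\<close>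

lemma finite_torhoms: "finite torhoms"
proof -
  obtain X where X: "finite X" "X \<subseteq> carrier \<Gamma>" "generate \<Gamma> X = carrier \<Gamma>"
    using fg by (auto simp: fin_gen_def)
  have "\<exists>n>0. proj x [^]\<^bsub>\<Gamma>\<^esub> (n::nat) \<in> N" if "x \<in> X" for x
    using proj_K[of x] that X(2) by (auto simp: saturation_def)
  then obtain n where n: "\<And>x. x \<in> X \<Longrightarrow> n x > (0::nat)" "\<And>x. x \<in> X \<Longrightarrow> proj x [^]\<^bsub>\<Gamma>\<^esub> n x \<in> N"
    by metis
  define S where "S x = {g \<in> carrier GG. g [^]\<^bsub>GG\<^esub> n x = \<one>\<^bsub>GG\<^esub>}" for x
  define r where "r h = (\<lambda>x\<in>X. h (N #>\<^bsub>\<Gamma>\<^esub> proj x))" for h :: "'g set \<Rightarrow> 'f Gelem"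
  have "inj_on r torhoms"
  proof (rule inj_onI)
    fix h h' assume h: "h \<in> torhoms" "h' \<in> torhoms" "r h = r h'"
    show "h = h'"
    proof (rule torhoms_eqI[OF h(1,2)])
      fix x assume x: "x \<in> K"
      then have xg: "x \<in> generate \<Gamma> X" using K_carrier X(3) by auto
      have "h (N #>\<^bsub>\<Gamma>\<^esub> proj y) = h' (N #>\<^bsub>\<Gamma>\<^esub> proj y)" if "y \<in> X" for y
        using fun_cong[OF h(3), of y] that by (simp add: r_def)
      from hom_eq_on_generate[OF \<Gamma>.is_group GG.is_group torhoms_hom[OF h(1)] torhoms_hom[OF h(2)] X(2) this xg]
      show "h (N #>\<^bsub>\<Gamma>\<^esub> x) = h' (N #>\<^bsub>\<Gamma>\<^esub> x)" using proj_on_K[OF x] by simp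
    qed
  qed
  moreover have "r ` torhoms \<subseteq> PiE X S"
  proof clarify
    fix h assume h: "h \<in> torhoms"
    have "h (N #>\<^bsub>\<Gamma>\<^esub> proj x) \<in> S x" if x: "x \<in> X" for x
    proof -
      have xc: "x \<in> carrier \<Gamma>" "proj x \<in> K" "proj x \<in> carrier \<Gamma>" using x X(2) proj_K K_carrier by auto
      have cl: "h (N #>\<^bsub>\<Gamma>\<^esub> proj y) \<in> carrier GG" if "y \<in> carrier \<Gamma>" for y
        using torhoms_hom[OF h] that by (auto simp: hom_def)
      \<comment> \<open>The power law is applied to the extension of \<open>h\<close> to \<Gamma> at
        the point \<open>proj x\<close>, hence the doubled projection.\<close>
      have "h (N #>\<^bsub>\<Gamma>\<^esub> proj (proj x)) [^]\<^bsub>GG\<^esub> n x = h (N #>\<^bsub>\<Gamma>\<^esub> proj (proj x [^]\<^bsub>\<Gamma>\<^esub> n x))"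
        using hom_nat_pow[OF torhoms_hom[OF h] xc(3) \<Gamma>.is_group GG.is_group, of "n x"] by simp
      also have "proj (proj x [^]\<^bsub>\<Gamma>\<^esub> n x) = proj x [^]\<^bsub>\<Gamma>\<^esub> n x"
        using n(2)[OF x] N_subset_K by (intro proj_on_K) auto
      also have "N #>\<^bsub>\<Gamma>\<^esub> (proj x [^]\<^bsub>\<Gamma>\<^esub> n x) = N #>\<^bsub>\<Gamma>\<^esub> proj \<one>\<^bsub>\<Gamma>\<^esub>"
        using n(2)[OF x] subgroup.one_closed[OF subK] subgroup.one_closed[OF subN]
        by (simp add: proj_on_K coset_N)
      also have "h (N #>\<^bsub>\<Gamma>\<^esub> proj \<one>\<^bsub>\<Gamma>\<^esub>) = \<one>\<^bsub>GG\<^esub>"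
        using hom_one[OF torhoms_hom[OF h] \<Gamma>.is_group GG.is_group] .
      finally show ?thesis using cl[OF xc(1)] proj_on_K[OF xc(2)] by (simp add: S_def)
    qed
    then show "r h \<in> PiE X S" by (auto simp: r_def)
  qed
  moreover have "finite (PiE X S)"
    unfolding S_def using X(1) n(1) finF by (intro finite_PiE finite_Ggrp_torsion) auto
  ultimately show ?thesis by (meson finite_imageD finite_subset)
qed

text \<open>The family \<open>e\<close> spans a free complement of \<open>K\<close>: \<open>h\<close> prescribes the values on \<open>K\<close>, and \<open>f\<close> the \<open>F\<close>-part
  on \<open>e\<close>.\<close>
definition build :: "('g set \<Rightarrow> 'f Gelem) \<times> (nat \<Rightarrow> 'f) \<Rightarrow> 'g \<Rightarrow> 'f Gelem" where
  "build = (\<lambda>(h, f). \<lambda>x\<in>carrier \<Gamma>. h (N #>\<^bsub>\<Gamma>\<^esub> proj x) \<otimes>\<^bsub>GG\<^esub>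
     (\<lambda>_. 1, \<lambda>_. 0, lincomb F f I (\<lambda>i. c i x)))"

lemma fpart_hom:
  assumes "f \<in> I \<rightarrow> carrier F"
  shows "(\<lambda>x. (\<lambda>_. 1, \<lambda>_. 0, lincomb F f I (\<lambda>i. c i x))) \<in> hom \<Gamma> GG"
proof (rule homI)
  show "(\<lambda>_. 1, \<lambda>_. 0, lincomb F f I (\<lambda>i. c i x)) \<in> carrier GG" for x
    using F.lincomb_closed[OF assms] by (auto simp: carrier_Ggrp circ_set_def real_set_def)
  fix x y assume xy: "x \<in> carrier \<Gamma>" "y \<in> carrier \<Gamma>"
  have "lincomb F f I (\<lambda>i. c i (x \<otimes>\<^bsub>\<Gamma>\<^esub> y)) = lincomb F f I (\<lambda>i. c i x + c i y)"
    using assms c_add xy by (intro F.finprod_cong') (auto simp: Pi_iff)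
  then show "((\<lambda>_. 1, \<lambda>_. 0, lincomb F f I (\<lambda>i. c i (x \<otimes>\<^bsub>\<Gamma>\<^esub> y))) :: 'f Gelem) =
      (\<lambda>_. 1, \<lambda>_. 0, lincomb F f I (\<lambda>i. c i x)) \<otimes>\<^bsub>GG\<^esub> (\<lambda>_. 1, \<lambda>_. 0, lincomb F f I (\<lambda>i. c i y))"
    by (simp add: mult_Ggrp F.lincomb_add[OF assms])
qed

lemma build_hom:
  assumes "h \<in> torhoms" "f \<in> I \<rightarrow> carrier F"
  shows "build (h, f) \<in> hom \<Gamma> GG"
proof (rule homI)
  let ?a = "\<lambda>x. h (N #>\<^bsub>\<Gamma>\<^esub> proj x)" and ?b = "\<lambda>x. (\<lambda>_. 1, \<lambda>_. 0, lincomb F f I (\<lambda>i. c i x)) :: 'f Gelem"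
  note a = torhoms_hom[OF assms(1)] and b = fpart_hom[OF assms(2)]
  have ac: "?a x \<in> carrier GG" "?b x \<in> carrier GG" if "x \<in> carrier \<Gamma>" for x
    using a b that by (auto simp: hom_def)
  show "build (h, f) x \<in> carrier GG" if "x \<in> carrier \<Gamma>" for x
    using ac[OF that] that by (simp add: build_def)
  show "build (h, f) (x \<otimes>\<^bsub>\<Gamma>\<^esub> y) = build (h, f) x \<otimes>\<^bsub>GG\<^esub> build (h, f) y"
    if "x \<in> carrier \<Gamma>" "y \<in> carrier \<Gamma>" for x y
  proof -
    have "build (h, f) (x \<otimes>\<^bsub>\<Gamma>\<^esub> y) = (?a x \<otimes>\<^bsub>GG\<^esub> ?a y) \<otimes>\<^bsub>GG\<^esub> (?b x \<otimes>\<^bsub>GG\<^esub> ?b y)"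
      using hom_mult[OF a that] hom_mult[OF b that] that by (simp add: build_def)
    also have "\<dots> = (?a x \<otimes>\<^bsub>GG\<^esub> ?b x) \<otimes>\<^bsub>GG\<^esub> (?a y \<otimes>\<^bsub>GG\<^esub> ?b y)"
      using ac that by (simp add: GG.m_ac)
    finally show ?thesis using that by (simp add: build_def)
  qed
qed

lemma build_on_K:
  assumes "h \<in> torhoms" "x \<in> K"
  shows "build (h, f) x = h (N #>\<^bsub>\<Gamma>\<^esub> x)"
proof -
  have xc: "x \<in> carrier \<Gamma>" using assms K_carrier by auto
  have "lincomb F f I (\<lambda>i. c i x) = \<one>\<^bsub>F\<^esub>" using c_0[OF _ assms(2)] by (intro F.finprod_one_eqI) auto
  then have "build (h, f) x = h (N #>\<^bsub>\<Gamma>\<^esub> proj x) \<otimes>\<^bsub>GG\<^esub> \<one>\<^bsub>GG\<^esub>"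
    using xc by (simp add: build_def one_Ggrp)
  moreover have "h (N #>\<^bsub>\<Gamma>\<^esub> proj x) \<in> carrier GG"
    using torhoms_hom[OF assms(1)] xc by (auto simp: hom_def)
  ultimately show ?thesis using proj_on_K[OF assms(2)] by simp
qed

lemma build_e:
  assumes "h \<in> torhoms" "f \<in> I \<rightarrow> carrier F" "i \<in> I"
  shows "snd (snd (build (h, f) (e i))) = f i"
proof -
  have ec: "e i \<in> carrier \<Gamma>" using assms(3) eI by auto
  have "lincomb F f I (\<lambda>j. c j (e i)) = lincomb F f I (\<lambda>j. if j = i then 1 else 0)"
    using assms(2,3) c_e by (intro F.finprod_cong') (auto simp: Pi_iff)
  also have "\<dots> = f i" using F.lincomb_single[OF assms(2) finI assms(3), of 1] assms(2,3) by (auto simp: Pi_iff)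
  finally have 1: "lincomb F f I (\<lambda>j. c j (e i)) = f i" .
  have "h (N #>\<^bsub>\<Gamma>\<^esub> proj (e i)) = h (N #>\<^bsub>\<Gamma>\<^esub> proj \<one>\<^bsub>\<Gamma>\<^esub>)"
    using proj_e[OF assms(3)] subgroup.one_closed[OF subK] by (simp add: proj_on_K)
  also have "\<dots> = \<one>\<^bsub>GG\<^esub>" using hom_one[OF torhoms_hom[OF assms(1)] \<Gamma>.is_group GG.is_group] .
  finally show ?thesis using 1 ec assms(2,3) by (auto simp: build_def mult_Ggrp one_Ggrp Pi_iff)
qed

lemma build_Ann:
  assumes "h \<in> torhoms" "f \<in> I \<rightarrow> carrier F"
  shows "build (h, f) \<in> Ann N"
proof -
  have "build (h, f) x = \<one>\<^bsub>GG\<^esub>" if x: "x \<in> N" for x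
  proof -
    have xK: "x \<in> K" and 1: "\<one>\<^bsub>\<Gamma>\<^esub> \<in> K" and xc: "x \<in> carrier \<Gamma>"
      using x N_subset_K N_carrier subgroup.one_closed[OF subK] by auto
    have "N #>\<^bsub>\<Gamma>\<^esub> x = N #>\<^bsub>\<Gamma>\<^esub> proj \<one>\<^bsub>\<Gamma>\<^esub>"
      using x 1 subgroup.one_closed[OF subN] by (simp add: proj_on_K coset_N)
    then show ?thesis using build_on_K[OF assms(1) xK] hom_one[OF torhoms_hom[OF assms(1)] \<Gamma>.is_group GG.is_group] by simp
  qed
  then show ?thesis
    using build_hom[OF assms] by (auto simp: annihilator_def Tspace_def homs_def) (simp add: build_def)
qed

text \<open>By \<open>connected_component_iff\<close> a component is determined by the common
  restriction to \<open>K\<close> and the common \<open>F\<close>-part. The restriction to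
  \<open>K\<close> is a homomorphism on the torsion of the quotient by \<open>N\<close>, and the
  remaining freedom in the \<open>F\<close>-part is its values on \<open>e\<close>.\<close>

lemma bij_betw_components:
  "bij_betw (\<lambda>d. connected_component_of_set (XX N) (build d)) (torhoms \<times> (I \<rightarrow>\<^sub>E carrier F))
     (connected_components_of (XX N))"
proof (rule bij_betw_imageI)
  show "inj_on (\<lambda>d. connected_component_of_set (XX N) (build d)) (torhoms \<times> (I \<rightarrow>\<^sub>E carrier F))"
  proof (rule inj_onI, clarify)
    fix h f h' f'
    assume h: "h \<in> torhoms" "h' \<in> torhoms" and f: "f \<in> I \<rightarrow>\<^sub>E carrier F" "f' \<in> I \<rightarrow>\<^sub>E carrier F"
      and eq: "connected_component_of_set (XX N) (build (h, f)) = connected_component_of_set (XX N) (build (h', f'))"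
    have f1: "f \<in> I \<rightarrow> carrier F" "f' \<in> I \<rightarrow> carrier F" using f by auto
    have "build (h', f') \<in> connected_component_of_set (XX N) (build (h', f'))"
      using build_Ann[OF h(2) f1(2)] by (rule component_refl)
    then have "connected_component_of (XX N) (build (h, f)) (build (h', f'))" unfolding eq[symmetric] by simp
    then have ag: "\<And>x. x \<in> K \<Longrightarrow> build (h, f) x = build (h', f') x"
      "\<And>x. x \<in> carrier \<Gamma> \<Longrightarrow> snd (snd (build (h, f) x)) = snd (snd (build (h', f') x))"
      by (auto simp: connected_component_iff)
    have "h = h'" using ag(1) by (intro torhoms_eqI h) (simp add: build_on_K h)
    moreover have "f = f'"
    proof (rule extensionalityI)
      fix i assume i: "i \<in> I"
      then have "e i \<in> carrier \<Gamma>" using eI by auto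
      from ag(2)[OF this] show "f i = f' i" using build_e h f1 i by simp
    qed (use f in \<open>auto simp: PiE_def\<close>)
    ultimately show "h = h' \<and> f = f'" by simp
  qed
  show "(\<lambda>d. connected_component_of_set (XX N) (build d)) ` (torhoms \<times> (I \<rightarrow>\<^sub>E carrier F)) =
      connected_components_of (XX N)"
  proof
    show "(\<lambda>d. connected_component_of_set (XX N) (build d)) ` (torhoms \<times> (I \<rightarrow>\<^sub>E carrier F)) \<subseteq>
      connected_components_of (XX N)"
      unfolding connected_components_of_def topspace_XX
    proof clarify
      fix h f assume "h \<in> torhoms" "f \<in> I \<rightarrow>\<^sub>E carrier F"
      then have "build (h, f) \<in> Ann N" by (intro build_Ann) auto
      then show "connected_component_of_set (XX N) (build (h, f)) \<in> connected_component_of_set (XX N) ` Ann N"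
        by (rule imageI)
    qed
    show "connected_components_of (XX N) \<subseteq>
      (\<lambda>d. connected_component_of_set (XX N) (build d)) ` (torhoms \<times> (I \<rightarrow>\<^sub>E carrier F))"
    proof
      fix C assume "C \<in> connected_components_of (XX N)"
      then obtain \<phi> where \<phi>: "\<phi> \<in> Ann N" "C = connected_component_of_set (XX N) \<phi>"
        by (auto simp: connected_components_of_def topspace_XX)
      note T = TspaceD[OF AnnD(1)[OF \<phi>(1)]]
      have cos: "\<phi> x = \<phi> y" if "x \<in> carrier \<Gamma>" "y \<in> carrier \<Gamma>" "N #>\<^bsub>\<Gamma>\<^esub> x = N #>\<^bsub>\<Gamma>\<^esub> y" for x y
      proof -
        have "x \<in> N #>\<^bsub>\<Gamma>\<^esub> y" using \<Gamma>.rcos_self[OF that(1) subN] that(3) by simp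
        then obtain n where n: "n \<in> N" "x = n \<otimes>\<^bsub>\<Gamma>\<^esub> y" by (auto simp: r_coset_def)
        then have "\<phi> x = \<phi> n \<otimes>\<^bsub>GG\<^esub> \<phi> y" using hom_mult[OF T(1), of n y] N_carrier that(2) by auto
        then show ?thesis using AnnD(2)[OF \<phi>(1) n(1)] T(3)[OF that(2)] by simp
      qed
      \<comment> \<open>As \<phi> vanishes on \<open>N\<close>, it factors through the
        quotient.\<close>
      obtain h0 where h0: "h0 \<in> hom (\<Gamma> Mod N) GG" "\<And>x. x \<in> carrier \<Gamma> \<Longrightarrow> h0 (N #>\<^bsub>\<Gamma>\<^esub> x) = \<phi> x"
      proof -
        have "\<exists>h0\<in>hom (\<Gamma> Mod N) GG. \<forall>x\<in>carrier \<Gamma>. h0 (N #>\<^bsub>\<Gamma>\<^esub> x) = \<phi> x"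
          by (rule FactGroup_universal[OF T(1) normalN]) (erule (2) cos, blast)
        then show ?thesis using that by blast
      qed
      \<comment> \<open>The two invariants of \<phi>: its restriction to the torsion of the
        quotient, and its \<open>F\<close>-part on the basis.\<close>
      define h where "h = restrict h0 (tor_set (\<Gamma> Mod N))"
      define f where "f = (\<lambda>i\<in>I. snd (snd (\<phi> (e i))))"
      have f: "f \<in> I \<rightarrow>\<^sub>E carrier F" "f \<in> I \<rightarrow> carrier F" using T(3) eI by (auto simp: f_def carrier_Ggrp Pi_iff)
      have h: "h \<in> torhoms"
      proof -
        have sub: "tor_set (\<Gamma> Mod N) \<subseteq> carrier (\<Gamma> Mod N)" by (auto simp: tor_set_def)
        have cl: "a \<otimes>\<^bsub>\<Gamma> Mod N\<^esub> b \<in> tor_set (\<Gamma> Mod N)" if "a \<in> tor_set (\<Gamma> Mod N)" "b \<in> tor_set (\<Gamma> Mod N)" for a b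
        proof -
          obtain x y where xy: "x \<in> K" "y \<in> K" "a = N #>\<^bsub>\<Gamma>\<^esub> x" "b = N #>\<^bsub>\<Gamma>\<^esub> y"
            using \<open>a \<in> tor_set _\<close> \<open>b \<in> tor_set _\<close> unfolding tor_set_FactGroup by blast
          then have "a \<otimes>\<^bsub>\<Gamma> Mod N\<^esub> b = N #>\<^bsub>\<Gamma>\<^esub> (x \<otimes>\<^bsub>\<Gamma>\<^esub> y)" using K_carrier by (auto simp del: mult_FactGroup intro!: coset_mult)
          then show ?thesis using subgroup.m_closed[OF subK xy(1,2)] unfolding tor_set_FactGroup by blast
        qed
        have "h \<in> hom (tor_group (\<Gamma> Mod N)) GG"
        proof (rule homI)
          fix a assume a: "a \<in> carrier (tor_group (\<Gamma> Mod N))"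
          then show "h a \<in> carrier GG" using h0(1) sub by (auto simp: hom_def h_def tor_group_def)
          fix b assume b: "b \<in> carrier (tor_group (\<Gamma> Mod N))"
          have ab: "a \<in> tor_set (\<Gamma> Mod N)" "b \<in> tor_set (\<Gamma> Mod N)" using a b by (auto simp: tor_group_def)
          then have "h0 (a \<otimes>\<^bsub>\<Gamma> Mod N\<^esub> b) = h0 a \<otimes>\<^bsub>GG\<^esub> h0 b" using sub by (intro hom_mult[OF h0(1)]) auto
          moreover have "a \<otimes>\<^bsub>tor_group (\<Gamma> Mod N)\<^esub> b = a \<otimes>\<^bsub>\<Gamma> Mod N\<^esub> b" by (simp add: tor_group_def)
          ultimately show "h (a \<otimes>\<^bsub>tor_group (\<Gamma> Mod N)\<^esub> b) = h a \<otimes>\<^bsub>GG\<^esub> h b"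
            using cl[OF ab] ab by (simp only: h_def restrict_apply if_True)
        qed
        then show ?thesis by (simp add: homs_def h_def tor_group_def)
      qed
      have agK: "\<phi> x = build (h, f) x" if "x \<in> K" for x
        using build_on_K[OF h that] h0(2)[of x] that K_carrier by (auto simp: h_def tor_set_FactGroup)
      have "snd (snd (\<phi> x)) = snd (snd (build (h, f) x))" if "x \<in> carrier \<Gamma>" for x
      proof (rule hom_eqI[OF F.comm_group_axioms _ _ _ _ that])
        show "(\<lambda>x. snd (snd (\<phi> x))) \<in> hom \<Gamma> F"
          using hom_compose[OF T(1) hom_Ggrp_snd] by (simp add: o_def)
        show "(\<lambda>x. snd (snd (build (h, f) x))) \<in> hom \<Gamma> F"
          using hom_compose[OF build_hom[OF h f(2)] hom_Ggrp_snd] by (simp add: o_def)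
        show "snd (snd (\<phi> (e i))) = snd (snd (build (h, f) (e i)))" if "i \<in> I" for i
          using build_e[OF h f(2) that] that by (simp add: f_def)
      qed (use agK in auto)
      then have "connected_component_of (XX N) \<phi> (build (h, f))"
        using agree_imp_connected_component[OF \<phi>(1) build_Ann[OF h f(2)] agK] by blast
      then have "C = connected_component_of_set (XX N) (build (h, f))"
        using \<phi>(2) connected_component_of_equiv by metis
      then show "C \<in> (\<lambda>d. connected_component_of_set (XX N) (build d)) ` (torhoms \<times> (I \<rightarrow>\<^sub>E carrier F))"
        using h f(1) by blast
    qed
  qed
qed

lemma finite_components: "finite (connected_components_of (XX N))"
  using bij_betw_finite[OF bij_betw_components] finite_torhoms finI finF by (simp add: finite_PiE)

lemma card_components:
  "card (connected_components_of (XX N)) = card torhoms * card (carrier F) ^ card I"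
  using bij_betw_same_card[OF bij_betw_components] finI by (simp add: card_cartesian_product card_PiE)

end

context hom_space
begin

lemma ex_hom_subspace:
  assumes "subgroup N \<Gamma>"
  obtains I e c where "hom_subspace \<Gamma> F p q N I e c"
    "grank \<Gamma> (carrier \<Gamma>) = grank \<Gamma> N + card I"
proof -
  obtain X where X: "finite X" "X \<subseteq> carrier \<Gamma>" "generate \<Gamma> X = carrier \<Gamma>"
    using fg by (auto simp: fin_gen_def)
  have sat: "\<forall>x\<in>carrier \<Gamma>. \<forall>k::int. k \<noteq> 0 \<longrightarrow> x [^]\<^bsub>\<Gamma>\<^esub> k \<in> saturation \<Gamma> N \<longrightarrow> x \<in> saturation \<Gamma> N"
    using \<Gamma>.saturation_int_pow[OF assms] by blast
  obtain I :: "nat set" and e and c :: "nat \<Rightarrow> 'g \<Rightarrow> int" where *: "finite I" "e \<in> I \<rightarrow> carrier \<Gamma>"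
    "\<And>x. x \<in> carrier \<Gamma> \<Longrightarrow> x \<otimes>\<^bsub>\<Gamma>\<^esub> inv\<^bsub>\<Gamma>\<^esub> (lincomb \<Gamma> e I (\<lambda>i. c i x)) \<in> saturation \<Gamma> N"
    "\<And>i x y. i \<in> I \<Longrightarrow> x \<in> carrier \<Gamma> \<Longrightarrow> y \<in> carrier \<Gamma> \<Longrightarrow> c i (x \<otimes>\<^bsub>\<Gamma>\<^esub> y) = c i x + c i y"
    "\<And>i x. i \<in> I \<Longrightarrow> x \<in> saturation \<Gamma> N \<Longrightarrow> c i x = 0"
    "\<And>i j. i \<in> I \<Longrightarrow> j \<in> I \<Longrightarrow> c i (e j) = (if i = j then 1 else 0)"
    "\<And>d. lincomb \<Gamma> e I d \<in> saturation \<Gamma> N \<Longrightarrow> \<forall>i\<in>I. d i = 0"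
    by (rule \<Gamma>.coordinates_modulo_saturated[OF X \<Gamma>.saturation_subgroup[OF assms] sat]) (rule that, assumption+)
  have "hom_subspace \<Gamma> F p q N I e c"
    by (intro hom_subspace.intro hom_subspace_axioms.intro hom_space_axioms) (fact assms *)+
  moreover have "grank \<Gamma> (carrier \<Gamma>) = grank \<Gamma> N + card I"
  proof (rule \<Gamma>.grank_basis[OF fg assms *(1,2)])
    show "\<exists>d. x \<otimes>\<^bsub>\<Gamma>\<^esub> inv\<^bsub>\<Gamma>\<^esub> (lincomb \<Gamma> e I d) \<in> saturation \<Gamma> N" if "x \<in> carrier \<Gamma>" for x
      by (rule exI) (rule *(3)[OF that])
  qed (rule *(7))
  ultimately show ?thesis by (rule that)
qed

text \<open>Collects the results in a form free of the chosen coordinates; the number of coordinates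
  becomes a difference of ranks.\<close>

lemma components_annihilator:
  assumes "subgroup N \<Gamma>"
  shows finite_components_annihilator: "finite (connected_components_of (XX N))"
    and card_components_annihilator: "card (connected_components_of (XX N)) =
      card (homs (tor_group (\<Gamma> Mod N)) GG) * card (carrier F) ^ (grank \<Gamma> (carrier \<Gamma>) - grank \<Gamma> N)"
    and component_vanishing: "\<And>C x. C \<in> connected_components_of (XX N) \<Longrightarrow> x \<in> carrier \<Gamma> \<Longrightarrow>
      (\<And>\<phi>. \<phi> \<in> C \<Longrightarrow> \<phi> x = \<one>\<^bsub>GG\<^esub>) \<Longrightarrow> x \<in> saturation \<Gamma> N"
proof -
  obtain I e c where I: "hom_subspace \<Gamma> F p q N I e c" and r: "grank \<Gamma> (carrier \<Gamma>) = grank \<Gamma> N + card I"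
    using ex_hom_subspace[OF assms] .
  interpret hom_subspace \<Gamma> F p q N I e c by (rule I)
  show "finite (connected_components_of (XX N))" by (rule finite_components)
  show "card (connected_components_of (XX N)) =
      card (homs (tor_group (\<Gamma> Mod N)) GG) * card (carrier F) ^ (grank \<Gamma> (carrier \<Gamma>) - grank \<Gamma> N)"
    using r by (simp add: card_components)
  show "x \<in> saturation \<Gamma> N" if "C \<in> connected_components_of (XX N)" "x \<in> carrier \<Gamma>"
      "\<And>\<phi>. \<phi> \<in> C \<Longrightarrow> \<phi> x = \<one>\<^bsub>GG\<^esub>" for C x
    by (rule component_vanishing_imp_saturation[OF that(1,2)]) (rule that(3))
qed

end

subsection \<open>The intersection poset\<close>

text \<open>The vanishing sums over intervals, together with the value 1 at \<open>x\<close>, are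
  the recursion that determines the Moebius function.\<close>

lemma mobius_eqI:
  fixes f :: "'a \<Rightarrow> int"
  assumes P: "finite P"
    and refl: "\<And>x. R x x" and antisym: "\<And>x y. R x y \<Longrightarrow> R y x \<Longrightarrow> x = y"
    and trans: "\<And>x y z. R x y \<Longrightarrow> R y z \<Longrightarrow> R x z"
    and x: "x \<in> P" "f x = 1"
    and sum: "\<And>y. y \<in> P \<Longrightarrow> R x y \<Longrightarrow> y \<noteq> x \<Longrightarrow> (\<Sum>z\<in>{z \<in> P. R x z \<and> R z y}. f z) = 0"
    and y: "y \<in> P" "R x y"
  shows "mobius P R x y = f y"
proof -
  \<comment> \<open>Depth \<open>n\<close> suffices for an interval of at most \<open>n + 1\<close>
    elements, because the interval shrinks strictly at each call. In the base case the interval is a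
    single point, so \<open>x = y\<close>.\<close>
  have "mobius_aux P R n x y = f y"
    if "card {z \<in> P. R x z \<and> R z y} \<le> Suc n" "y \<in> P" "R x y" for n y
    using that
  proof (induction n arbitrary: y)
    case 0
    have "{x, y} \<subseteq> {z \<in> P. R x z \<and> R z y}" using 0 x refl by auto
    then have "card {x, y} \<le> card {z \<in> P. R x z \<and> R z y}" using P by (intro card_mono) auto
    then have "card {x, y} \<le> Suc 0" using 0(1) by simp
    then have "x = y" by (cases "x = y") auto
    then show ?case using x by simp
  next
    case (Suc n)
    show ?case
    proof (cases "x = y")
      case False
      let ?I = "{z \<in> P. R x z \<and> R z y}"
      have I: "?I = insert y {z \<in> P. R x z \<and> R z y \<and> z \<noteq> y}" using Suc.prems refl by auto
      have "mobius_aux P R n x z = f z" if z: "z \<in> P" "R x z" "R z y" "z \<noteq> y" for z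
      proof (rule Suc.IH)
        have "{w \<in> P. R x w \<and> R w z} \<subset> ?I"
          using z Suc.prems refl trans antisym by blast
        then have "card {w \<in> P. R x w \<and> R w z} < card ?I"
          using P by (intro psubset_card_mono) auto
        then show "card {w \<in> P. R x w \<and> R w z} \<le> Suc n" using Suc.prems(1) by simp
      qed (use z in auto)
      then have "mobius_aux P R (Suc n) x y = - (\<Sum>z\<in>{z \<in> P. R x z \<and> R z y \<and> z \<noteq> y}. f z)"
        using False Suc.prems by simp
      also have "\<dots> = f y"
        using sum[OF Suc.prems(2,3)] False P unfolding I by simp
      finally show ?thesis .
    qed (use x in simp)
  qed
  moreover have "card {z \<in> P. R x z \<and> R z y} \<le> Suc (card P)"
    using card_mono[OF P, of "{z \<in> P. R x z \<and> R z y}"] by auto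
  ultimately show ?thesis using y unfolding mobius_def by blast
qed

text \<open>The expansion of the product of the factors \<open>1 - 1\<close> over \<open>X\<close>;
  an empty product is 1.\<close>

lemma sum_Pow_neg_one_power_card:
  assumes "finite X" shows "(\<Sum>S\<in>Pow X. (- 1 :: int) ^ card S) = (if X = {} then 1 else 0)"
  using prod_diff_conv_sum[OF assms, of "\<lambda>_. 1 :: int" "\<lambda>_. 1"] assms by (auto simp: power_0_left)

lemma pcompose_monom:
  "pcompose (monom a k) (monom b g) = monom (a * b ^ k :: 'a :: comm_semiring_1) (g * k)"
proof -
  have "pcompose (monom a k) (monom b g) = monom a 0 * monom b g ^ k"
    by (simp add: pcompose_altdef map_poly_monom poly_monom monom_0)
  then show ?thesis by (simp add: monom_power mult_monom)
qed

section \<open>The arrangement: components of the subgroups attached to sublists\<close>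

locale abelian_arrangement = hom_space \<Gamma> F p q
  for \<Gamma> :: "('g, 'b) monoid_scheme" and F :: "('f, 'e) monoid_scheme" and p q :: nat +
  fixes A :: "'g list"
  assumes A_carrier: "set A \<subseteq> carrier \<Gamma>"
begin

abbreviation "J \<equiv> {..<length A}"
abbreviation "H S \<equiv> Hsub \<Gamma> A p q F S"
abbreviation "gen S \<equiv> generate \<Gamma> ((\<lambda>i. A ! i) ` S)"
abbreviation "comps S \<equiv> connected_components_of (subtopology TT (H S))"
abbreviation "LL \<equiv> Lposet \<Gamma> A p q F"
abbreviation "containing C \<equiv> {i. i < length A \<and> C \<subseteq> H {i}}"

lemma A_nth: "i \<in> J \<Longrightarrow> A ! i \<in> carrier \<Gamma>"
  using A_carrier nth_mem by fastforce

lemma A_image: "S \<subseteq> J \<Longrightarrow> (\<lambda>i. A ! i) ` S \<subseteq> carrier \<Gamma>"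
  using A_nth by auto

lemma sub_gen: "S \<subseteq> J \<Longrightarrow> subgroup (gen S) \<Gamma>"
  using A_image by (intro \<Gamma>.generate_is_subgroup)

lemma trivial_Tspace: "(\<lambda>x\<in>carrier \<Gamma>. \<one>\<^bsub>GG\<^esub>) \<in> Tspace \<Gamma> p q F"
  by (auto simp: Tspace_def homs_def hom_def)

lemma H_eq_Ann:
  assumes "S \<subseteq> J" shows "H S = Ann (gen S)"
proof -
  have "\<phi> x = \<one>\<^bsub>GG\<^esub>" if \<phi>: "\<phi> \<in> H S" and x: "x \<in> gen S" for \<phi> x
  proof -
    have T: "\<phi> \<in> Tspace \<Gamma> p q F" using \<phi> by (simp add: Hsub_def)
    have xc: "x \<in> carrier \<Gamma>" using x \<Gamma>.generate_in_carrier[OF A_image[OF assms]] by simp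
    have "\<phi> x = (\<lambda>x\<in>carrier \<Gamma>. \<one>\<^bsub>GG\<^esub>) x"
      by (rule hom_eq_on_generate[OF \<Gamma>.is_group GG.is_group TspaceD(1)[OF T] TspaceD(1)[OF trivial_Tspace]
            A_image[OF assms] _ x])
         (use \<phi> assms A_nth in \<open>auto simp: Hsub_def\<close>)
    then show ?thesis using xc by simp
  qed
  moreover have "A ! i \<in> gen S" if "i \<in> S" for i using that by (intro generate.incl imageI)
  ultimately show ?thesis by (fastforce simp: annihilator_def Hsub_def)
qed

lemma H_nonempty: "S \<subseteq> J \<Longrightarrow> H S \<noteq> {}"
proof -
  assume "S \<subseteq> J"
  then have "(\<lambda>x\<in>carrier \<Gamma>. \<one>\<^bsub>GG\<^esub>) \<in> H S"
    using trivial_Tspace A_nth by (auto simp: Hsub_def)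
  then show ?thesis by blast
qed

lemma LL_eq: "LL = (\<Union>S\<in>Pow J. comps S)"
proof -
  have "{comps S |S. S \<subseteq> J \<and> H S \<noteq> {}} = comps ` Pow J"
    using H_nonempty by (auto simp only: image_iff Pow_iff)
  then show ?thesis unfolding Lposet_def by (simp only:)
qed

lemma topspace_H: "topspace (subtopology TT (H S)) = H S"
  by (auto simp: topspace_TT Hsub_def)

lemma H_empty: "H {} = topspace TT"
  by (auto simp: topspace_TT Hsub_def)

lemma comps_empty: "comps {} = connected_components_of TT"
  unfolding H_empty subtopology_topspace ..

lemma comps_H: "C \<in> comps S \<Longrightarrow> C \<subseteq> H S"
  by (drule connected_components_of_subset) (simp only: topspace_H)

lemma comps_nonempty: "C \<in> comps S \<Longrightarrow> C \<noteq> {}"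
  by (rule nonempty_connected_components_of)

lemma comps_connectedin: "C \<in> comps S \<Longrightarrow> connectedin TT C"
  by (drule connectedin_connected_components_of) (simp only: connectedin_subtopology)

lemma comps_containing: "C \<in> comps S \<Longrightarrow> S \<subseteq> J \<Longrightarrow> S \<subseteq> containing C"
  using comps_H[of C S] by (auto simp: Hsub_def)

lemma finite_comps: "S \<subseteq> J \<Longrightarrow> finite (comps S)"
  using finite_components_annihilator[OF sub_gen] H_eq_Ann by simp

lemma card_comps:
  "S \<subseteq> J \<Longrightarrow> card (comps S) = mult_G \<Gamma> A p q F S * card (carrier F) ^ (grank \<Gamma> (carrier \<Gamma>) - rk_sub \<Gamma> A S)"
  using card_components_annihilator[OF sub_gen] H_eq_Ann by (simp add: mult_G_def rk_sub_def)

lemma comps_containing_saturation: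
  assumes "C \<in> comps S" "S \<subseteq> J" "i \<in> containing C"
  shows "A ! i \<in> saturation \<Gamma> (gen S)"
proof (rule component_vanishing[OF sub_gen[OF assms(2)]])
  show "C \<in> connected_components_of (XX (gen S))" using assms H_eq_Ann by simp
  show "A ! i \<in> carrier \<Gamma>" using assms(3) A_nth by auto
  show "\<phi> (A ! i) = \<one>\<^bsub>GG\<^esub>" if "\<phi> \<in> C" for \<phi> using that assms(3) by (auto simp: Hsub_def)
qed

text \<open>Elements vanishing on \<open>C\<close> lie in the saturation of \<open>gen S\<close>, so
  they do not raise the rank. Thus \<open>Ldim\<close> can be computed from any sublist having
  \<open>C\<close> as a component.\<close>

lemma rk_sub_containing:
  assumes "C \<in> comps S" "S \<subseteq> J"
  shows "rk_sub \<Gamma> A (containing C) = rk_sub \<Gamma> A S"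
  unfolding rk_sub_def
proof (rule \<Gamma>.grank_eq_of_saturation[OF fg])
  show "gen S \<subseteq> gen (containing C)"
    using comps_containing[OF assms] by (intro \<Gamma>.mono_generate image_mono)
  show "gen (containing C) \<subseteq> saturation \<Gamma> (gen S)"
    using comps_containing_saturation[OF assms] \<Gamma>.saturation_subgroup[OF sub_gen[OF assms(2)]]
    by (intro \<Gamma>.generate_subgroup_incl) auto
  show "gen S \<subseteq> carrier \<Gamma>" using sub_gen[OF assms(2)] by (rule subgroup.subset)
qed

text \<open>\<open>C\<close> is connected and contained in \<open>H S'\<close>, so it lies in the
  component of any of its points; two components sharing such a point coincide.\<close>

lemma ex1_comps_superset:
  assumes "C \<in> comps S" "S \<subseteq> J" "S' \<subseteq> containing C"
  shows "\<exists>!C'. C' \<in> comps S' \<and> C \<subseteq> C'"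
proof -
  have CT: "C \<subseteq> Tspace \<Gamma> p q F" using comps_H[OF assms(1)] by (auto simp: Hsub_def)
  have CH: "C \<subseteq> H S'" using assms(3) CT by (auto simp: Hsub_def)
  have con: "connectedin (subtopology TT (H S')) C"
    using comps_connectedin[OF assms(1)] CH by (simp add: connectedin_subtopology)
  obtain \<phi> where \<phi>: "\<phi> \<in> C" using comps_nonempty[OF assms(1)] by auto
  let ?C = "connected_component_of_set (subtopology TT (H S')) \<phi>"
  show ?thesis
  proof (rule ex1I[of _ ?C])
    have "\<phi> \<in> topspace (subtopology TT (H S'))" using \<phi> CH topspace_H by auto
    then show "?C \<in> comps S' \<and> C \<subseteq> ?C"
      using connected_component_of_maximal[OF con \<phi>] by (simp only: connected_component_in_connected_components_of)
    fix C' assume C': "C' \<in> comps S' \<and> C \<subseteq> C'"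
    then obtain \<psi> where \<psi>: "C' = connected_component_of_set (subtopology TT (H S')) \<psi>"
      unfolding connected_components_of_def by auto
    then have "connected_component_of (subtopology TT (H S')) \<psi> \<phi>" using C' \<phi> by auto
    then show "C' = ?C" unfolding \<psi> using connected_component_of_equiv[THEN iffD1, THEN conjunct2, THEN conjunct2] by metis
  qed
qed

lemma Tcomp_props:
  assumes "C \<in> comps S" "S \<subseteq> J"
  shows "Tcomp \<Gamma> p q F C \<in> comps {}" "C \<subseteq> Tcomp \<Gamma> p q F C"
proof -
  have "\<exists>!D. D \<in> connected_components_of TT \<and> C \<subseteq> D"
    using ex1_comps_superset[OF assms empty_subsetI] unfolding comps_empty .
  from theI'[OF this] show "Tcomp \<Gamma> p q F C \<in> comps {}" "C \<subseteq> Tcomp \<Gamma> p q F C"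
    unfolding Tcomp_def comps_empty by (rule conjunct1, rule conjunct2)
qed

section \<open>Signed weights and the Moebius function\<close>

definition weight :: "('g \<Rightarrow> 'f Gelem) set \<Rightarrow> int" where
  "weight C = (\<Sum>S\<in>{S \<in> Pow J. C \<in> comps S}. (- 1) ^ card S)"

lemma finite_LL: "finite LL"
  unfolding LL_eq using finite_comps by auto

lemma LL_E: "C \<in> LL \<Longrightarrow> (\<And>S. S \<subseteq> J \<Longrightarrow> C \<in> comps S \<Longrightarrow> P) \<Longrightarrow> P"
  unfolding LL_eq by auto

text \<open>After exchanging the sums, a sublist \<open>S\<close> contributes its sign once for
  every component of \<open>H S\<close> containing \<open>C\<close>. There is exactly one if
  \<open>S\<close> lies in \<open>containing C\<close> and none otherwise, which leaves an
  alternating sum over a power set.\<close>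

lemma sum_weight_above:
  assumes C: "C \<in> LL"
  shows "(\<Sum>z\<in>{z \<in> LL. C \<subseteq> z}. weight z) = (if containing C = {} then 1 else 0)"
proof -
  obtain S0 where S0: "S0 \<subseteq> J" "C \<in> comps S0" using C by (rule LL_E)
  have fin: "finite {z \<in> LL. C \<subseteq> z}" "finite (Pow J)" using finite_LL by auto
  have "(\<Sum>z\<in>{z \<in> LL. C \<subseteq> z}. weight z) =
      (\<Sum>S\<in>Pow J. \<Sum>z\<in>{z \<in> {z \<in> LL. C \<subseteq> z}. z \<in> comps S}. (- 1) ^ card S)"
    unfolding weight_def using fin by (rule sum.swap_restrict)
  also have "\<dots> = (\<Sum>S\<in>Pow J. if S \<subseteq> containing C then (- 1) ^ card S else 0)"
  proof (rule sum.cong[OF refl])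
    fix S assume S: "S \<in> Pow J"
    show "(\<Sum>z\<in>{z \<in> {z \<in> LL. C \<subseteq> z}. z \<in> comps S}. (- 1) ^ card S) =
        (if S \<subseteq> containing C then (- 1) ^ card S else (0::int))"
    proof (cases "S \<subseteq> containing C")
      case True
      from ex1_comps_superset[OF S0(2,1) True] obtain C' where
        "C' \<in> comps S" "C \<subseteq> C'" "\<And>z. z \<in> comps S \<Longrightarrow> C \<subseteq> z \<Longrightarrow> z = C'" by (elim ex1E) blast
      then have "{z \<in> {z \<in> LL. C \<subseteq> z}. z \<in> comps S} = {C'}" unfolding LL_eq using S by blast
      then show ?thesis using True by simp
    next
      case False
      \<comment> \<open>A component of \<open>H S\<close> containing \<open>C\<close> would force
        \<open>S\<close> into \<open>containing C\<close>.\<close>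
      have "containing z \<subseteq> containing C" if "C \<subseteq> z" for z using that by auto
      then have "{z \<in> {z \<in> LL. C \<subseteq> z}. z \<in> comps S} = {}"
        using False comps_containing[of _ S] S by blast
      then show ?thesis using False by (simp only: sum.empty if_False)
    qed
  qed
  also have "\<dots> = (\<Sum>S\<in>{S \<in> Pow J. S \<subseteq> containing C}. (- 1) ^ card S)"
    by (rule sum.inter_filter[OF fin(2), symmetric])
  also have "{S \<in> Pow J. S \<subseteq> containing C} = Pow (containing C)" by auto
  also have "(\<Sum>S\<in>Pow (containing C). (- 1) ^ card S) = (if containing C = {} then 1 else (0::int))"
    by (rule sum_Pow_neg_one_power_card) simp
  finally show ?thesis .
qed

text \<open>An element vanishing on a whole component of \<open>T\<close> lies in the saturation of
  the trivial subgroup, which is the torsion subgroup. So every index in \<open>containing D\<close>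
  meets the torsion condition in \<open>scc\<close>.\<close>

lemma scc_iff:
  assumes "D \<in> comps {}"
  shows "D \<in> scc \<Gamma> A p q F \<longleftrightarrow> containing D = {}"
proof -
  have "A ! i \<in> tor_set \<Gamma>" if "i \<in> containing D" for i
    using comps_containing_saturation[OF assms empty_subsetI that] \<Gamma>.generate_empty
    by (simp add: saturation_def tor_set_def)
  then show ?thesis using assms comps_empty by (auto simp: scc_def)
qed

text \<open>\<open>z\<close> is connected and meets \<open>D\<close> in the nonempty set
  \<open>C\<close>. Hence summing over all of \<open>L\<close> above \<open>C\<close> never leaves
  the component \<open>D\<close>.\<close>

lemma LL_below_component:
  assumes "D \<in> comps {}" "C \<in> LL" "C \<subseteq> D" "z \<in> LL" "C \<subseteq> z"
  shows "z \<subseteq> D"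
proof (rule connected_components_of_maximal)
  show "D \<in> connected_components_of TT" using assms(1) comps_empty by simp
  show "connectedin TT z" using assms(4) by (rule LL_E) (rule comps_connectedin)
  have "C \<noteq> {}" using assms(2) by (rule LL_E) (rule comps_nonempty)
  then show "\<not> disjnt D z" using assms(3,5) by (auto simp: disjnt_def)
qed

text \<open>Induction from larger to smaller sets. The weights of all elements containing
  \<open>C\<close> sum to zero, since \<open>containing C\<close> includes the nonempty
  \<open>containing D\<close>, and all terms but that of \<open>C\<close> vanish by
  induction.\<close>

lemma weight_eq_0:
  assumes D: "D \<in> comps {}" "containing D \<noteq> {}" and C: "C \<in> LL" "C \<subseteq> D"
  shows "weight C = 0"
  using C
proof (induction "card {z \<in> LL. C \<subseteq> z}" arbitrary: C rule: less_induct)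
  case less
  have split: "{z \<in> LL. C \<subseteq> z} = insert C {z \<in> LL. C \<subset> z}" using less.prems by auto
  have "weight z = 0" if z: "z \<in> LL" "C \<subset> z" for z
  proof (rule less.hyps)
    have "{w \<in> LL. z \<subseteq> w} \<subset> {w \<in> LL. C \<subseteq> w}" using z less.prems by auto
    then show "card {w \<in> LL. z \<subseteq> w} < card {w \<in> LL. C \<subseteq> w}"
      using finite_LL by (intro psubset_card_mono) auto
    show "z \<subseteq> D" using LL_below_component[OF D(1) less.prems z(1)] z(2) by auto
  qed (rule z)
  then have "(\<Sum>z\<in>{z \<in> LL. C \<subseteq> z}. weight z) = weight C"
    unfolding split using finite_LL by (subst sum.insert) auto
  moreover have "containing C \<noteq> {}" using D(2) less.prems(2) by auto
  ultimately show ?case using sum_weight_above[OF less.prems(1)] by (simp only: if_False)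
qed

lemma comps_subset_eq:
  assumes "D \<in> comps {}" "C \<in> comps {}" "C \<subseteq> D" shows "C = D"
proof -
  obtain E where E: "\<And>z. z \<in> comps {} \<and> C \<subseteq> z \<Longrightarrow> z = E"
    using ex1_comps_superset[OF assms(2) empty_subsetI empty_subsetI] by (elim ex1E) (rule that, simp only:)
  then show ?thesis using E[of C] E[of D] assms by simp
qed

lemma weight_scc:
  assumes "D \<in> comps {}" "containing D = {}" shows "weight D = 1"
proof -
  have "{S \<in> Pow J. D \<in> comps S} = {{}}"
    using assms comps_containing[of D] by blast
  then show ?thesis by (simp add: weight_def)
qed

text \<open>In the reverse inclusion order, the interval from \<open>D\<close> to \<open>y\<close>
  consists of all elements of \<open>L\<close> containing \<open>y\<close>, so
  \<open>sum_weight_above\<close> provides the recursion required by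
  \<open>mobius_eqI\<close>.\<close>

lemma mobius_eq_weight:
  assumes C: "C \<in> LL" "C \<subseteq> D" and D: "D \<in> comps {}" "containing D = {}"
  shows "mobius LL (\<lambda>C D. D \<subseteq> C) D C = weight C"
proof (rule mobius_eqI[where f = weight])
  show "D \<in> LL" using D(1) LL_eq by auto
  fix y assume y: "y \<in> LL" "y \<subseteq> D" "y \<noteq> D"
  \<comment> \<open>Otherwise \<open>y\<close> could only come from the empty sublist. It would then
    be a component of \<open>T\<close> inside \<open>D\<close>, hence \<open>D\<close>
    itself.\<close>
  have "containing y \<noteq> {}"
  proof
    assume e: "containing y = {}"
    obtain S where S: "S \<subseteq> J" "y \<in> comps S" using y(1) by (rule LL_E)
    then have "S = {}" using comps_containing[OF S(2,1)] e by blast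
    then show False using comps_subset_eq[OF D(1) _ y(2)] S y(3) by simp
  qed
  moreover have "{z \<in> LL. z \<subseteq> D \<and> y \<subseteq> z} = {z \<in> LL. y \<subseteq> z}"
    using LL_below_component[OF D(1) y(1,2)] by blast
  ultimately show "(\<Sum>z\<in>{z \<in> LL. z \<subseteq> D \<and> y \<subseteq> z}. weight z) = 0"
    using sum_weight_above[OF y(1)] by (simp only: if_False)
qed (use C finite_LL weight_scc[OF D] in auto)

text \<open>On \<open>Lpar\<close> the weight is the Moebius value, and outside it the weight is
  zero, so the sum may run over the whole poset.\<close>

lemma chi_par_eq_sum_weight: "chi_par \<Gamma> A p q F = (\<Sum>C\<in>LL. monom (weight C) (Ldim \<Gamma> A p q F C))"
proof -
  have Lpar: "Lpar \<Gamma> A p q F \<subseteq> LL" unfolding Lpar_def by (rule Collect_restrict)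
  have props: "Tcomp \<Gamma> p q F C \<in> comps {}" "C \<subseteq> Tcomp \<Gamma> p q F C" if C: "C \<in> LL" for C
  proof -
    obtain S where S: "S \<subseteq> J" "C \<in> comps S" using C by (rule LL_E)
    show "Tcomp \<Gamma> p q F C \<in> comps {}" "C \<subseteq> Tcomp \<Gamma> p q F C" using Tcomp_props[OF S(2,1)] .
  qed
  have "chi_par \<Gamma> A p q F = (\<Sum>C\<in>Lpar \<Gamma> A p q F. monom (weight C) (Ldim \<Gamma> A p q F C))"
    unfolding chi_par_def
  proof (rule sum.cong[OF refl])
    fix C assume "C \<in> Lpar \<Gamma> A p q F"
    then have C: "C \<in> LL" "Tcomp \<Gamma> p q F C \<in> scc \<Gamma> A p q F" by (auto simp: Lpar_def)
    have "containing (Tcomp \<Gamma> p q F C) = {}" using C(2) scc_iff[OF props(1)[OF C(1)]] by simp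
    from mobius_eq_weight[OF C(1) props(2,1)[OF C(1)] this]
    show "monom (mobius LL (\<lambda>C D. D \<subseteq> C) (Tcomp \<Gamma> p q F C) C) (Ldim \<Gamma> A p q F C) =
        monom (weight C) (Ldim \<Gamma> A p q F C)" by simp
  qed
  also have "\<dots> = (\<Sum>C\<in>LL. monom (weight C) (Ldim \<Gamma> A p q F C))"
  proof (rule sum.mono_neutral_left[OF finite_LL Lpar], rule ballI)
    fix C assume "C \<in> LL - Lpar \<Gamma> A p q F"
    then have C: "C \<in> LL" "Tcomp \<Gamma> p q F C \<notin> scc \<Gamma> A p q F" by (auto simp: Lpar_def)
    have "containing (Tcomp \<Gamma> p q F C) \<noteq> {}" using C(2) scc_iff[OF props(1)[OF C(1)]] by simp
    from weight_eq_0[OF props(1)[OF C(1)] this C(1) props(2)[OF C(1)]]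
    show "monom (weight C) (Ldim \<Gamma> A p q F C) = 0" by simp
  qed
  finally show ?thesis .
qed

section \<open>Comparison of the two polynomials\<close>

lemma chi_par_eq:
  "chi_par \<Gamma> A p q F = (\<Sum>S\<in>Pow J. monom ((- 1) ^ card S * int (card (comps S)))
     ((p + q) * (grank \<Gamma> (carrier \<Gamma>) - rk_sub \<Gamma> A S)))"
proof -
  have "chi_par \<Gamma> A p q F = (\<Sum>C\<in>LL. \<Sum>S\<in>{S \<in> Pow J. C \<in> comps S}. monom ((- 1) ^ card S) (Ldim \<Gamma> A p q F C))"
    unfolding chi_par_eq_sum_weight weight_def monom_sum ..
  also have "\<dots> = (\<Sum>S\<in>Pow J. \<Sum>C\<in>{C \<in> LL. C \<in> comps S}. monom ((- 1) ^ card S) (Ldim \<Gamma> A p q F C))"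
    using finite_LL by (intro sum.swap_restrict) auto
  also have "\<dots> = (\<Sum>S\<in>Pow J. monom ((- 1) ^ card S * int (card (comps S)))
     ((p + q) * (grank \<Gamma> (carrier \<Gamma>) - rk_sub \<Gamma> A S)))"
  proof (rule sum.cong[OF refl])
    fix S assume "S \<in> Pow J"
    then have S: "S \<subseteq> J" by simp
    have "{C \<in> LL. C \<in> comps S} = comps S" using S unfolding LL_eq by blast
    \<comment> \<open>All components of one \<open>H S\<close> have the same dimension, so the inner
      sum merely counts them.\<close>
    moreover have "Ldim \<Gamma> A p q F C = (p + q) * (grank \<Gamma> (carrier \<Gamma>) - rk_sub \<Gamma> A S)" if "C \<in> comps S" for C
      using rk_sub_containing[OF that S] by (simp add: Ldim_def)
    ultimately have "(\<Sum>C\<in>{C \<in> LL. C \<in> comps S}. monom ((- 1) ^ card S) (Ldim \<Gamma> A p q F C)) =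
        (\<Sum>C\<in>comps S. monom ((- 1 :: int) ^ card S) ((p + q) * (grank \<Gamma> (carrier \<Gamma>) - rk_sub \<Gamma> A S)))"
      by (intro sum.cong) auto
    then show "(\<Sum>C\<in>{C \<in> LL. C \<in> comps S}. monom ((- 1) ^ card S) (Ldim \<Gamma> A p q F C)) =
        monom ((- 1) ^ card S * int (card (comps S))) ((p + q) * (grank \<Gamma> (carrier \<Gamma>) - rk_sub \<Gamma> A S))"
      by (simp add: of_nat_monom mult_monom mult.commute)
  qed
  finally show ?thesis .
qed

text \<open>These inequalities make the subtractions of natural numbers in the exponents of
  \<open>chi_G\<close> and \<open>tutte_G\<close> exact.\<close>

lemma rk_sub_bounds:
  assumes "S \<subseteq> J"
  shows "rk_sub \<Gamma> A S \<le> card S" "rk_sub \<Gamma> A S \<le> rk_sub \<Gamma> A J" "rk_sub \<Gamma> A J \<le> grank \<Gamma> (carrier \<Gamma>)"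
proof -
  have "finite S" using assms finite_subset by blast
  then show "rk_sub \<Gamma> A S \<le> card S"
    unfolding rk_sub_def
    using le_trans[OF \<Gamma>.grank_generate_le_card[OF fg _ A_image[OF assms]] card_image_le] by blast
  show "rk_sub \<Gamma> A S \<le> rk_sub \<Gamma> A J"
    unfolding rk_sub_def using assms sub_gen[of J]
    by (intro \<Gamma>.grank_mono[OF fg] \<Gamma>.mono_generate image_mono) (auto dest: subgroup.subset)
  show "rk_sub \<Gamma> A J \<le> grank \<Gamma> (carrier \<Gamma>)"
    unfolding rk_sub_def using sub_gen[of J]
    by (intro \<Gamma>.grank_mono[OF fg]) (auto dest: subgroup.subset)
qed

text \<open>At \<open>x = 1 - t\<close> and \<open>y = 0\<close> the two bases become
  \<open>-t\<close> and \<open>-1\<close>, so each summand is a single monomial.\<close>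

lemma chi_G_eq:
  "chi_G \<Gamma> A p q F = (\<Sum>S\<in>Pow J. monom ((- 1) ^ card S * int (mult_G \<Gamma> A p q F S))
     (grank \<Gamma> (carrier \<Gamma>) - rk_sub \<Gamma> A S))"
  unfolding chi_G_def tutte_G_def sum_distrib_left
proof (rule sum.cong[OF refl])
  fix S assume "S \<in> Pow J"
  then have S: "S \<subseteq> J" by simp
  define rA rS r m where "rA = rk_sub \<Gamma> A J" and "rS = rk_sub \<Gamma> A S" and "r = grank \<Gamma> (carrier \<Gamma>)"
    and "m = mult_G \<Gamma> A p q F S"
  have le: "rS \<le> card S" "rS \<le> rA" "rA \<le> r"
    using rk_sub_bounds[OF S] by (auto simp: rA_def rS_def r_def)
  have m1: "(- 1 :: int poly) ^ k = monom ((- 1) ^ k) 0" for k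
    by (metis monom_power mult_0 monom_0 one_pCons minus_monom)
  have x: "(1 - [:0, 1:]) - (1 :: int poly) = monom (- 1) 1"
    by (simp add: monom_altdef)
  \<comment> \<open>The exponents of -1 add up to \<open>card S\<close> plus twice
    \<open>rA - rS\<close>.\<close>
  have sign: "(- 1 :: int) ^ rA * ((- 1) ^ (rA - rS) * (- 1) ^ (card S - rS)) = (- 1) ^ card S"
  proof -
    have "rA + (rA - rS) + (card S - rS) = card S + 2 * (rA - rS)" using le by simp
    then have "(- 1 :: int) ^ rA * ((- 1) ^ (rA - rS) * (- 1) ^ (card S - rS)) = (- 1) ^ (card S + 2 * (rA - rS))"
      by (simp only: power_add[symmetric] add.assoc[symmetric])
    then show ?thesis by (simp add: power_add power_mult)
  qed
  have "(- 1) ^ rA * monom 1 (r - rA) * (of_nat m * ((1 - [:0, 1:]) - 1) ^ (rA - rS) * (0 - 1) ^ (card S - rS)) =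
      monom ((- 1) ^ rA * ((- 1) ^ (rA - rS) * (- 1) ^ (card S - rS)) * int m) (r - rA + (rA - rS))"
    unfolding x by (simp add: m1 monom_power of_nat_monom mult_monom ac_simps)
  also have "\<dots> = monom ((- 1) ^ card S * int m) (r - rS)" unfolding sign using le by simp
  finally show "(- 1) ^ rk_sub \<Gamma> A J * monom 1 (grank \<Gamma> (carrier \<Gamma>) - rk_sub \<Gamma> A J) *
      (of_nat (mult_G \<Gamma> A p q F S) * ((1 - [:0, 1:]) - 1) ^ (rk_sub \<Gamma> A J - rk_sub \<Gamma> A S) *
       (0 - 1) ^ (card S - rk_sub \<Gamma> A S)) =
      monom ((- 1) ^ card S * int (mult_G \<Gamma> A p q F S)) (grank \<Gamma> (carrier \<Gamma>) - rk_sub \<Gamma> A S)"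
    unfolding rA_def rS_def r_def m_def .
qed

text \<open>The two sums agree term by term: the substitution raises \<open>#F\<close> to the power
  \<open>r_\<Gamma> - r_S\<close>, which by \<open>card_comps\<close> turns the multiplicity of
  \<open>S\<close> into the number of components of \<open>H S\<close>.\<close>

lemma chi_par_eq_pcompose_chi_G:
  "chi_par \<Gamma> A p q F = pcompose (chi_G \<Gamma> A p q F) (monom (int (card (carrier F))) (p + q))"
  unfolding chi_par_eq chi_G_eq pcompose_sum pcompose_monom
  by (intro sum.cong refl) (auto simp: card_comps mult.assoc)

end

theorem theorem3p7:
  fixes \<Gamma> :: "('g, 'b) monoid_scheme" and A :: "'g list"
    and F :: "('f, 'e) monoid_scheme" and p q :: nat
  assumes "comm_group \<Gamma>" and "fin_gen \<Gamma>" and "set A \<subseteq> carrier \<Gamma>"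
    and "comm_group F" and "finite (carrier F)"
    and "p + q > 0"
  shows "chi_par \<Gamma> A p q F = pcompose (chi_G \<Gamma> A p q F) (monom (int (card (carrier F))) (p + q))"
proof -
  interpret \<Gamma>: comm_group \<Gamma> by fact
  interpret F: comm_group F by fact
  interpret abelian_arrangement \<Gamma> F p q A
    using assms by unfold_locales auto
  show ?thesis by (rule chi_par_eq_pcompose_chi_G)
qed

end
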